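(* Let $X$ be a separable Banach lattice. The following are equivalent. (1) The set $$X_{\downarrow 0}=\{(x_n)_{n=1}^\infty\in X^{\mathbb N} : x_1\geqslant x_2\geqslant \ldots\geqslant 0=\inf_n x_n\}$$ is Borel in $X^{\mathbb N}$. (2) The set $$\{((x_n)_{n=1}^\infty,x)\in X^{\mathbb N}\times X : (x_n) \text{ } \sigma\text{-order converges to } x\}$$ is analytic in $X^{\mathbb N}\times X$. (3) $X$ is $\alpha$-Fatou for some ordinal $\alpha<\omega_1$.
   Context: $X$ carries its norm topology, and $X^{\mathbb N}$ and $X^{\mathbb N}\times X$ the product topologies (these are Polish spaces). $X^+=\{x\in X: x\geqslant 0\}$, and $u^+=u\vee 0$. "$\inf_n x_n=0$" means that $0$ is the greatest lower bound of $\{x_n\}$ in $X$. Analytic means ${\bf \Sigma}^1_1$. A sequence $(x_n)$ in $X$ $\sigma$-order converges to $x\in X$ if there is a decreasing sequence $(z_m)_{m=1}^\infty$ in $X$ with infimum $0$ such that for every $m$ we have $|x_n-x|\leqslant z_m$ for all but finitely many $n$. Trees and rank. For a set $\Sigma$, $\Sigma^{<\mathbb N}$ is the set of all finite strings of elements of $\Sigma$. A tree is a subset $T\subseteq\Sigma^{<\mathbb N}$ containing the empty string $\emptyset$ and closed under initial segments. $T$ is ill-founded if there is an infinite sequence $(y_n)_{n=1}^\infty$ in $\Sigma$ with $(y_1,\ldots,y_n)\in T$ for all $n$; otherwise it is well-founded. For a well-founded tree $T$, $\rho_T(s)=0$ if $s\in T$ has no proper extension in $T$, and otherwise $\rho_T(s)=\sup\{\rho_T(t)+1: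 t\in T,\ s\subsetneq t\}$. The rank of $T$ is $\rho(T)=\rho_T(\emptyset)+1$. If $T$ is ill-founded, set $\rho(T)=\infty$, which is larger than every ordinal. Let $X_\downarrow=\{(z_n)_{n=1}^\infty\in X^{\mathbb N}: z_1\geqslant z_2\geqslant\ldots\geqslant 0\}$. For $(z_n)\in X_\downarrow$, let $\Psi((z_n))\subseteq (X^+\setminus\{0\})^{<\mathbb N}$ be the tree of all finite strings $(y_1,\ldots,y_k)$ such that $\|(y_i-z_n)^+\|\leqslant \|y_i\|/3^i$ for all $1\leqslant i\leqslant k$ and all $n\geqslant 1$, and $\|y_{i+1}-y_i\|\leqslant \|y_i\|/3^i$ for all $1\leqslant i<k$. For an ordinal $\alpha$, a separable Banach lattice $X$ is $\alpha$-Fatou if for every $(z_n)\in X_\downarrow$: $\inf_n z_n=0$ if and only if $\rho(\Psi((z_n)))\leqslant\alpha$. *)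

theory Defs
  imports
    "HOL-Analysis.Analysis"
    "HOL-Library.Lattice_Algebras"
    "HOL-Library.Lub_Glb"
    "HOL-Library.Sublist"
    "HOL-Library.Extended"
begin

(* The symbol infinity is left to the Analysis library; Pinf is written out below. *)
no_notation Pinf (\<open>\<infinity>\<close>) and Minf (\<open>-\<infinity>\<close>)

section \<open>Banach lattices\<close>

class banach_lattice = banach + ordered_real_vector + lattice_ab_group_add_abs +
  assumes norm_mono_abs: "\<bar>x\<bar> \<le> \<bar>y\<bar> \<Longrightarrow> norm x \<le> norm y"

text \<open>Norm separability, spelled out because \<^const>\<open>separable_space\<close> and \<^const>\<open>closure\<close> cannot be
  applied to the type under definition inside a class specification.\<close>

class separable_banach_lattice = banach_lattice +
  assumes ex_countable_dense:
    "\<exists>D :: 'a set. countable D \<and> (\<forall>U. open U \<longrightarrow> U \<noteq> {} \<longrightarrow> D \<inter> U \<noteq> {})"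

instance real :: separable_banach_lattice
proof (intro_classes)
  obtain D :: "real set" where D: "countable D" "\<And>U. open U \<Longrightarrow> U \<noteq> {} \<Longrightarrow> \<exists>d\<in>D. d \<in> U"
    using countable_dense_setE[where 'a = real] by metis
  have "D \<inter> U \<noteq> {}" if "open U" "U \<noteq> {}" for U
    using D(2)[OF that] by auto
  with D(1) show "\<exists>D :: real set. countable D \<and> (\<forall>U. open U \<longrightarrow> U \<noteq> {} \<longrightarrow> D \<inter> U \<noteq> {})"
    by (intro exI[of _ D]) simp
qed (simp only: real_norm_def)

instance separable_banach_lattice \<subseteq> polish_space
proof
  obtain D :: "'a set" where D: "countable D" "\<And>U. open U \<Longrightarrow> U \<noteq> {} \<Longrightarrow> D \<inter> U \<noteq> {}"
    using ex_countable_dense[where 'a='a] by blast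
  define B :: "'a set set" where "B = (\<lambda>(d, q). ball d (of_rat q)) ` (D \<times> UNIV)"
  have cB: "countable B"
    unfolding B_def using D(1) by (intro countable_image countable_SIGMA) auto
  have "topological_basis B"
  proof (rule topological_basisI)
    show "open b" if "b \<in> B" for b
      using that by (auto simp: B_def)
  next
    fix U :: "'a set" and x assume U: "open U" "x \<in> U"
    then obtain e where e: "e > 0" "ball x e \<subseteq> U"
      using open_contains_ball by blast
    obtain q where q: "e / 3 < of_rat q" "of_rat q < e / 2"
      using of_rat_dense[of "e / 3" "e / 2"] e by auto
    have "D \<inter> ball x (e / 3) \<noteq> {}" using D(2)[of "ball x (e / 3)"] e(1) by simp
    then obtain d where d: "d \<in> D" "dist d x < e / 3"
      by (auto simp: dist_commute)
    have "x \<in> ball d (of_rat q)" using d q by simp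
    moreover have "ball d (of_rat q) \<subseteq> U"
    proof
      fix y assume "y \<in> ball d (of_rat q)"
      then have "dist x y < e"
        using d q dist_triangle[of x y d] by (simp add: dist_commute)
      then show "y \<in> U" using e by auto
    qed
    ultimately show "\<exists>b\<in>B. x \<in> b \<and> b \<subseteq> U"
      using d(1) unfolding B_def by blast
  qed
  then have "open = generate_topology B"
    by (rule topological_basis_imp_subbasis)
  with cB show "\<exists>B::'a set set. countable B \<and> open = generate_topology B" by blast
qed


section \<open>Order convergence of sequences\<close>

text \<open>Sequences are indexed from \<open>0\<close>: the term \<open>x\<^sub>n\<close> of the literature is \<open>x (n - 1)\<close>.\<close>

definition X_down :: "(nat \<Rightarrow> 'a::banach_lattice) set" where
  "X_down = {z. decseq z \<and> (\<forall>n. 0 \<le> z n)}"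

definition X_down0 :: "(nat \<Rightarrow> 'a::banach_lattice) set" where
  "X_down0 = {z \<in> X_down. isGlb UNIV (range z) 0}"

definition sigma_order_converges :: "(nat \<Rightarrow> 'a::banach_lattice) \<Rightarrow> 'a \<Rightarrow> bool" where
  "sigma_order_converges x l \<longleftrightarrow>
     (\<exists>z. decseq z \<and> isGlb UNIV (range z) 0 \<and>
          (\<forall>m. \<forall>\<^sub>F n in sequentially. \<bar>x n - l\<bar> \<le> z m))"


section \<open>Analytic sets\<close>

text \<open>\<open>\<Sigma>\<^sup>1\<^sub>1\<close> sets (boldface), for \<open>'b\<close> a Polish space: projections of closed subsets of
  \<open>'b \<times> \<N>\<^sup>\<N>\<close>, where \<open>\<N>\<^sup>\<N>\<close> is the Baire space.\<close>

definition analytic_set :: "'b::topological_space set \<Rightarrow> bool" where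
  "analytic_set A \<longleftrightarrow> (\<exists>C :: ('b \<times> (nat \<Rightarrow> nat)) set. closed C \<and> A = fst ` C)"


section \<open>Ordinals\<close>

text \<open>An element of \<open>'u ordinal\<close> is the order type of a well-order whose field is a subset of
  \<open>'u\<close>; for infinite \<open>'u\<close> these are the ordinals below the cardinal successor of \<open>'u\<close>.\<close>

lemma Well_order_empty: "Well_order {}"
  by (simp add: well_order_on_def linear_order_on_def partial_order_on_def preorder_on_def
      total_on_def trans_def antisym_def refl_on_def)

quotient_type 'u ordinal = "'u rel" / partial: "\<lambda>r s. (r, s) \<in> ordIso"
proof (rule part_equivpI)
  show "\<exists>r::'u rel. (r, r) \<in> ordIso"
    using ordIso_reflexive[OF Well_order_empty] by blast
  show "symp (\<lambda>r s. (r :: 'u rel, s) \<in> ordIso)"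
    by (rule sympI) (rule ordIso_symmetric)
  show "transp (\<lambda>r s. (r :: 'u rel, s) \<in> ordIso)"
    by (rule transpI) (rule ordIso_transitive)
qed

lemma ordinal_cases:
  obtains r where "\<alpha> = abs_ordinal r" "Well_order r"
  using Quotient_abs_rep[OF Quotient_ordinal, of \<alpha>] Quotient_rep_reflp[OF Quotient_ordinal, of \<alpha>]
  by (metis ordIso_iff_ordLeq ordLeq_Well_order_simp)

instantiation ordinal :: (type) "{zero, ord}"
begin

lift_definition zero_ordinal :: "'a ordinal" is "{}"
  by (rule ordIso_reflexive[OF Well_order_empty])

lift_definition less_eq_ordinal :: "'a ordinal \<Rightarrow> 'a ordinal \<Rightarrow> bool"
  is "\<lambda>r s. (r, s) \<in> ordLeq"
  by (meson ordIso_ordLeq_trans ordIso_symmetric ordLeq_ordIso_trans)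

lift_definition less_ordinal :: "'a ordinal \<Rightarrow> 'a ordinal \<Rightarrow> bool"
  is "\<lambda>r s. (r, s) \<in> ordLess"
  by (meson ordIso_ordLess_trans ordIso_symmetric ordLess_ordIso_trans)

instance ..

end

lemma abs_ordinal_le:
  "Well_order r \<Longrightarrow> Well_order s \<Longrightarrow> abs_ordinal r \<le> abs_ordinal s \<longleftrightarrow> (r, s) \<in> ordLeq"
  by (simp add: less_eq_ordinal.abs_eq ordIso_reflexive)

lemma abs_ordinal_less:
  "Well_order r \<Longrightarrow> Well_order s \<Longrightarrow> abs_ordinal r < abs_ordinal s \<longleftrightarrow> (r, s) \<in> ordLess"
  by (simp add: less_ordinal.abs_eq ordIso_reflexive)

lemma abs_ordinal_eq:
  "Well_order r \<Longrightarrow> Well_order s \<Longrightarrow> abs_ordinal r = abs_ordinal s \<longleftrightarrow> (r, s) \<in> ordIso"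
  using Quotient_rel[OF Quotient_ordinal, of r s] by (auto simp: ordIso_reflexive)

instance ordinal :: (type) wellorder
proof
  fix x y z :: "'a ordinal"
  obtain r where r: "x = abs_ordinal r" "Well_order r" by (rule ordinal_cases)
  obtain s where s: "y = abs_ordinal s" "Well_order s" by (rule ordinal_cases)
  obtain t where t: "z = abs_ordinal t" "Well_order t" by (rule ordinal_cases)
  show "x < y \<longleftrightarrow> x \<le> y \<and> \<not> y \<le> x"
    using r s by (metis abs_ordinal_le abs_ordinal_less not_ordLeq_iff_ordLess ordLess_imp_ordLeq)
  show "x \<le> x" using r by (simp add: abs_ordinal_le ordLeq_reflexive)
  show "x \<le> y \<Longrightarrow> y \<le> z \<Longrightarrow> x \<le> z"
    using r s t by (metis abs_ordinal_le ordLeq_transitive)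
  show "x \<le> y \<Longrightarrow> y \<le> x \<Longrightarrow> x = y"
    using r s by (metis abs_ordinal_le abs_ordinal_eq ordIso_iff_ordLeq)
  show "x \<le> y \<or> y \<le> x"
    using r s by (metis abs_ordinal_le ordLeq_total)
next
  fix P :: "'a ordinal \<Rightarrow> bool" and a :: "'a ordinal"
  assume step: "\<And>x. (\<And>y. y < x \<Longrightarrow> P y) \<Longrightarrow> P x"
  have "Well_order r \<longrightarrow> P (abs_ordinal r)" for r :: "'a rel"
  proof (induction r rule: wf_induct_rule[OF wf_ordLess])
    case (1 r)
    show ?case
    proof
      assume r: "Well_order r"
      show "P (abs_ordinal r)"
      proof (rule step)
        fix y assume y: "y < abs_ordinal r"
        obtain s where s: "y = abs_ordinal s" "Well_order s" by (rule ordinal_cases)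
        then show "P y" using y 1 r abs_ordinal_less by blast
      qed
    qed
  qed
  then show "P a" by (metis ordinal_cases)
qed

definition ord_succ :: "'u ordinal \<Rightarrow> 'u ordinal" where
  "ord_succ \<alpha> = (LEAST \<beta>. \<alpha> < \<beta>)"

definition ord_Sup :: "'u ordinal set \<Rightarrow> 'u ordinal" where
  "ord_Sup A = (LEAST \<beta>. \<forall>\<alpha>\<in>A. \<alpha> \<le> \<beta>)"

text \<open>This is the first uncountable ordinal provided \<open>'u\<close> is uncountable;
  only such \<open>'u\<close> are used below.\<close>

definition omega1 :: "'u ordinal" where
  "omega1 = (LEAST \<alpha>. uncountable {..<\<alpha>})"

lemma ordLeq_empty: "Well_order r \<Longrightarrow> ({} :: 'u rel, r :: 'u rel) \<in> ordLeq"
  using not_ordLeq_iff_ordLess[of r "{} :: 'u rel"] ordLess_iff_ordIso_Restr[of "{} :: 'u rel" r]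
  by (auto simp: Well_order_empty)

lemma ordinal_zero_le: "(0 :: 'u ordinal) \<le> \<alpha>"
proof -
  obtain r where r: "\<alpha> = abs_ordinal r" "Well_order r" by (rule ordinal_cases)
  then show ?thesis
    by (simp add: zero_ordinal_def abs_ordinal_le Well_order_empty ordLeq_empty)
qed

definition seg_ordinal :: "'u rel \<Rightarrow> 'u \<Rightarrow> 'u ordinal" where
  "seg_ordinal r a = abs_ordinal (Restr r (underS r a))"

lemma ordinal_segment:
  assumes "Well_order r"
  shows "{..<abs_ordinal r} = seg_ordinal r ` Field r"
proof
  show "seg_ordinal r ` Field r \<subseteq> {..<abs_ordinal r}"
  proof
    fix y assume "y \<in> seg_ordinal r ` Field r"
    then obtain a where a: "a \<in> Field r" "y = seg_ordinal r a" by blast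
    then have "(Restr r (underS r a), r) \<in> ordLess"
      using underS_Restr_ordLess[OF assms] by blast
    then show "y \<in> {..<abs_ordinal r}"
      using a assms by (simp add: seg_ordinal_def abs_ordinal_less Well_order_Restr)
  qed
  show "{..<abs_ordinal r} \<subseteq> seg_ordinal r ` Field r"
  proof
    fix y assume y: "y \<in> {..<abs_ordinal r}"
    obtain s where s: "y = abs_ordinal s" "Well_order s" by (rule ordinal_cases)
    then have "(s, r) \<in> ordLess" using y assms by (simp add: abs_ordinal_less)
    then obtain a where a: "a \<in> Field r" "(s, Restr r (underS r a)) \<in> ordIso"
      using ordLess_iff_ordIso_Restr[OF assms s(2)] by blast
    then have "y = seg_ordinal r a"
      using s assms by (simp add: seg_ordinal_def abs_ordinal_eq Well_order_Restr)
    then show "y \<in> seg_ordinal r ` Field r" using a by blast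
  qed
qed

lemma seg_ordinal_less:
  assumes r: "Well_order r" and ab: "(a, b) \<in> r" "a \<noteq> b"
  shows "seg_ordinal r a < seg_ordinal r b"
proof -
  have wo: "wo_rel r" by (simp add: wo_rel_def r)
  have "underS r a \<subset> underS r b"
    using ab wo_rel.TRANS[OF wo] wo_rel.ANTISYM[OF wo]
    unfolding underS_def trans_def antisym_def by blast
  then have "(Restr r (underS r a), Restr r (underS r b)) \<in> ordLess"
    using ofilter_subset_ordLess[OF r wo_rel.underS_ofilter[OF wo] wo_rel.underS_ofilter[OF wo]]
    by blast
  then show ?thesis by (simp add: seg_ordinal_def abs_ordinal_less Well_order_Restr r)
qed

lemma seg_ordinal_inj:
  assumes r: "Well_order r"
  shows "inj_on (seg_ordinal r) (Field r)"
proof (rule inj_onI, rule ccontr)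
  have wo: "wo_rel r" by (simp add: wo_rel_def r)
  fix a b assume ab: "a \<in> Field r" "b \<in> Field r" "seg_ordinal r a = seg_ordinal r b" "a \<noteq> b"
  then have "(a, b) \<in> r \<or> (b, a) \<in> r" using wo_rel.TOTALS[OF wo] by blast
  then show False using ab seg_ordinal_less[OF r] by (metis less_irrefl)
qed

text \<open>Successors exist, and so do suprema of all sets of ordinals no larger than \<open>'u\<close>.\<close>

lemma ordinal_bounded:
  fixes S :: "'u ordinal set"
  assumes inf: "infinite (UNIV :: 'u set)"
    and S: "(card_of S, card_of (UNIV :: 'u set)) \<in> ordLeq"
  shows "\<exists>\<beta>. \<forall>\<alpha>\<in>S. \<alpha> < \<beta>"
proof (rule ccontr)
  assume "\<not> ?thesis"
  then have "\<forall>\<beta>. \<exists>\<alpha>\<in>S. \<beta> \<le> \<alpha>" by (meson not_le)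
  then have U: "(UNIV :: 'u ordinal set) = (\<Union>\<alpha>\<in>S. {..\<alpha>})" by auto
  have "(card_of {..\<alpha>}, card_of (UNIV :: 'u set)) \<in> ordLeq" for \<alpha> :: "'u ordinal"
  proof -
    obtain r where r: "\<alpha> = abs_ordinal r" "Well_order r" by (rule ordinal_cases)
    have "(card_of {..<\<alpha>}, card_of (Field r)) \<in> ordLeq"
      unfolding r(1) ordinal_segment[OF r(2)] by (rule card_of_image)
    then have "(card_of {..<\<alpha>}, card_of (UNIV :: 'u set)) \<in> ordLeq"
      by (meson card_of_mono1 ordLeq_transitive subset_UNIV)
    moreover have "(card_of {\<alpha>}, card_of (UNIV :: 'u set)) \<in> ordLeq"
      by (simp add: card_of_singl_ordLeq)
    moreover have "{..\<alpha>} = {..<\<alpha>} \<union> {\<alpha>}" by auto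
    ultimately show ?thesis
      using card_of_Un_ordLeq_infinite_Field[of "card_of (UNIV :: 'u set)" "{..<\<alpha>}" "{\<alpha>}"]
        inf card_of_Card_order[of "UNIV :: 'u set"] by (metis Field_card_of)
  qed
  then have "(card_of (\<Union>\<alpha>\<in>S. {..\<alpha>}), card_of (UNIV :: 'u set)) \<in> ordLeq"
    using card_of_UNION_ordLeq_infinite[OF inf S] by blast
  then have "(card_of (UNIV :: 'u ordinal set), card_of (UNIV :: 'u set)) \<in> ordLeq"
    using U by simp
  then obtain f :: "'u ordinal \<Rightarrow> 'u" where f: "inj f"
    using card_of_ordLeq[of "UNIV :: 'u ordinal set" "UNIV :: 'u set"] by blast
  define W where "W = {(x, y :: 'u ordinal). x \<le> y}"
  have FW: "Field W = UNIV" by (auto simp: W_def Field_def)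
  have "W - Id = {(x, y). x < y}" by (auto simp: W_def)
  then have W: "Well_order W"
    using wf FW
    by (auto simp: well_order_on_def linear_order_on_def partial_order_on_def preorder_on_def
        total_on_def trans_def antisym_def refl_on_def W_def)
  define r where "r = dir_image W f"
  have r: "Well_order r"
    unfolding r_def by (rule Well_order_dir_image[OF W]) (use f FW in simp)
  have rf: "(f x, f y) \<in> r" if "x \<le> y" for x y
    using that unfolding r_def dir_image_def W_def by blast
  define g where "g \<beta> = seg_ordinal r (f \<beta>)" for \<beta>
  have mono: "g x < g y" if "x < y" for x y
    unfolding g_def using that f by (intro seg_ordinal_less[OF r] rf) (auto dest: injD)
  have ge: "\<beta> \<le> g \<beta>" for \<beta>
  proof (induction \<beta> rule: less_induct)
    case (less \<beta>)
    show ?case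
    proof (rule ccontr)
      assume "\<not> \<beta> \<le> g \<beta>"
      then have "g \<beta> < \<beta>" by simp
      then have "g (g \<beta>) < g \<beta>" "g \<beta> \<le> g (g \<beta>)" using mono less by auto
      then show False by simp
    qed
  qed
  have "f (abs_ordinal r) \<in> Field r" using rf[of "abs_ordinal r" "abs_ordinal r"]
    by (auto simp: Field_def)
  then have "g (abs_ordinal r) < abs_ordinal r"
    using ordinal_segment[OF r] unfolding g_def by blast
  with ge show False by (metis not_le)
qed

lemma ord_succ_le_iff:
  fixes \<alpha> :: "'u ordinal"
  assumes inf: "infinite (UNIV :: 'u set)"
  shows "ord_succ \<alpha> \<le> \<beta> \<longleftrightarrow> \<alpha> < \<beta>"
proof -
  have "(card_of {\<alpha>}, card_of (UNIV :: 'u set)) \<in> ordLeq"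
    by (simp add: card_of_singl_ordLeq)
  then obtain \<gamma> where "\<alpha> < \<gamma>" using ordinal_bounded[OF inf] by blast
  then have "\<alpha> < ord_succ \<alpha>" unfolding ord_succ_def by (rule LeastI)
  then show ?thesis unfolding ord_succ_def by (metis Least_le order_less_le_trans)
qed

lemma ord_Sup_le_iff:
  fixes S :: "'u ordinal set"
  assumes inf: "infinite (UNIV :: 'u set)"
    and S: "(card_of S, card_of (UNIV :: 'u set)) \<in> ordLeq"
  shows "ord_Sup S \<le> \<beta> \<longleftrightarrow> (\<forall>\<alpha>\<in>S. \<alpha> \<le> \<beta>)"
proof -
  obtain \<gamma> where "\<forall>\<alpha>\<in>S. \<alpha> \<le> \<gamma>" using ordinal_bounded[OF inf S] by (meson less_imp_le)
  then have "\<forall>\<alpha>\<in>S. \<alpha> \<le> ord_Sup S" unfolding ord_Sup_def by (rule LeastI)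
  moreover have "ord_Sup S \<le> \<beta>" if "\<forall>\<alpha>\<in>S. \<alpha> \<le> \<beta>"
    unfolding ord_Sup_def using that by (rule Least_le)
  ultimately show ?thesis using order_trans by blast
qed

lemma less_omega1_iff:
  fixes \<alpha> :: "'u ordinal"
  assumes "uncountable (UNIV :: 'u set)"
  shows "\<alpha> < omega1 \<longleftrightarrow> countable {..<\<alpha>}"
proof -
  obtain r :: "'u rel" where "well_order_on UNIV r" using well_order_on by blast
  then have r: "Well_order r" "Field r = UNIV"
    using well_order_on_Well_order by (auto simp: well_order_on_Field)
  have "uncountable {..<abs_ordinal r}"
    unfolding ordinal_segment[OF r(1)]
    using assms r(2) seg_ordinal_inj[OF r(1)] countable_image_inj_on by metis
  then have "uncountable {..<omega1 :: 'u ordinal}"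
    unfolding omega1_def by (rule LeastI)
  then show ?thesis
    unfolding omega1_def
    by (metis countable_subset lessThan_subset_iff not_le not_less_Least)
qed


section \<open>Trees and their rank\<close>

text \<open>Finite strings are lists; the entry \<open>y\<^sub>i\<close> of a string \<open>ys\<close> is \<open>ys ! (i - 1)\<close>.\<close>

definition tree_over :: "'a set \<Rightarrow> 'a list set \<Rightarrow> bool" where
  "tree_over \<Sigma> T \<longleftrightarrow> T \<subseteq> lists \<Sigma> \<and> [] \<in> T \<and> (\<forall>t\<in>T. \<forall>s. prefix s t \<longrightarrow> s \<in> T)"

definition ill_founded :: "'a list set \<Rightarrow> bool" where
  "ill_founded T \<longleftrightarrow> (\<exists>y :: nat \<Rightarrow> 'a. \<forall>n. map y [0..<n] \<in> T)"

text \<open>Ranks of trees of strings over \<open>'a\<close> are taken in \<open>'a list set ordinal\<close>: the universe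
  \<open>'a list set\<close> is always uncountable, and it is large enough for every supremum below to exist.\<close>

definition node_rank :: "'a list set \<Rightarrow> 'a list \<Rightarrow> 'a list set ordinal" where
  "node_rank T = wfrec {(t, s). t \<in> T \<and> s \<in> T \<and> strict_prefix s t}
     (\<lambda>rk s. if \<exists>t\<in>T. strict_prefix s t
             then ord_Sup {ord_succ (rk t) | t. t \<in> T \<and> strict_prefix s t}
             else 0)"

text \<open>\<open>Pinf\<close> is the rank \<open>\<infinity>\<close> of ill-founded trees; \<open>Minf\<close> does not occur.\<close>

definition tree_rank :: "'a list set \<Rightarrow> 'a list set ordinal extended" where
  "tree_rank T = (if ill_founded T then Pinf else Fin (ord_succ (node_rank T [])))"

lemma wf_extension:
  assumes T: "tree_over \<Sigma> T" and nill: "\<not> ill_founded T"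
  shows "wf {(t, s). t \<in> T \<and> s \<in> T \<and> strict_prefix s t}"
proof (unfold wf_iff_no_infinite_down_chain, rule notI, elim exE)
  fix f assume "\<forall>i. (f (Suc i), f i) \<in> {(t, s). t \<in> T \<and> s \<in> T \<and> strict_prefix s t}"
  then have f: "f i \<in> T" "strict_prefix (f i) (f (Suc i))" for i by auto
  have len: "i \<le> length (f i)" for i
  proof (induction i)
    case (Suc i)
    then show ?case using prefix_length_less[OF f(2)[of i]] by simp
  qed simp
  define y where "y i = f (Suc i) ! i" for i
  have pre: "prefix (f i) (f j)" if "i \<le> j" for i j
    using that by (induction rule: dec_induct) (use f(2) in \<open>auto simp: strict_prefix_def intro: prefix_order.trans\<close>)
  have "map y [0..<n] = take n (f n)" for n
  proof (rule nth_equalityI)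
    show "length (map y [0..<n]) = length (take n (f n))" using len[of n] by simp
    fix i assume "i < length (map y [0..<n])"
    then have i: "i < n" by simp
    then have "prefix (f (Suc i)) (f n)" using pre by simp
    then have "f (Suc i) ! i = f n ! i"
      using len[of "Suc i"] by (auto simp: prefix_def nth_append)
    then show "map y [0..<n] ! i = take n (f n) ! i" using i by (simp add: y_def)
  qed
  moreover have "take n (f n) \<in> T" for n
    using T f(1)[of n] take_is_prefix[of n "f n"] unfolding tree_over_def by blast
  ultimately show False using nill unfolding ill_founded_def by metis
qed

lemma node_rank_eq:
  assumes "tree_over \<Sigma> T" "\<not> ill_founded T" "s \<in> T"
  shows "node_rank T s =
    (if \<exists>t\<in>T. strict_prefix s t
     then ord_Sup {ord_succ (node_rank T t) | t. t \<in> T \<and> strict_prefix s t} else 0)"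
proof -
  let ?R = "{(t, s). t \<in> T \<and> s \<in> T \<and> strict_prefix s t}"
  let ?F = "\<lambda>rk s. if \<exists>t\<in>T. strict_prefix s t
    then ord_Sup {ord_succ (rk t) | t. t \<in> T \<and> strict_prefix s t} else 0"
  have "{ord_succ (cut (node_rank T) ?R s t) | t. t \<in> T \<and> strict_prefix s t}
      = {ord_succ (node_rank T t) | t. t \<in> T \<and> strict_prefix s t}"
    using assms(3) by (force simp: cut_def)
  moreover have "node_rank T s = ?F (cut (node_rank T) ?R s) s"
    unfolding node_rank_def by (rule wfrec[OF wf_extension[OF assms(1,2)]])
  ultimately show ?thesis by (simp only:)
qed

lemma uncountable_list_set: "uncountable (UNIV :: 'a list set set)"
proof
  assume "countable (UNIV :: 'a list set set)"
  moreover have "inj (\<lambda>A :: nat set. (\<lambda>n. replicate n (undefined :: 'a)) ` A)"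
    by (rule inj_image_eq_iff[THEN iffD1, THEN injI]) (auto intro: injI dest: arg_cong[of _ _ length])
  ultimately have "countable (UNIV :: nat set set)"
    by (metis countable_image_inj_on countable_subset subset_UNIV)
  then have "range (from_nat_into (UNIV :: nat set set)) = Pow UNIV"
    by (simp add: range_from_nat_into)
  then show False using Cantors_theorem by blast
qed

lemma node_rank_le_iff:
  fixes T :: "'a list set"
  assumes "tree_over \<Sigma> T" "\<not> ill_founded T" "s \<in> T"
  shows "node_rank T s \<le> \<beta> \<longleftrightarrow> (\<forall>t\<in>T. strict_prefix s t \<longrightarrow> node_rank T t < \<beta>)"
proof -
  have inf: "infinite (UNIV :: 'a list set set)"
    using uncountable_list_set countable_finite by blast
  let ?S = "{ord_succ (node_rank T t) | t. t \<in> T \<and> strict_prefix s t}"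
  have "?S = (\<lambda>t. ord_succ (node_rank T t)) ` {t \<in> T. strict_prefix s t}" by blast
  then have "(card_of ?S, card_of {t \<in> T. strict_prefix s t}) \<in> ordLeq"
    using card_of_image by (simp only:)
  moreover have "inj_on (\<lambda>t. {t}) {t \<in> T. strict_prefix s t}" by simp
  then have "(card_of {t \<in> T. strict_prefix s t}, card_of (UNIV :: 'a list set set)) \<in> ordLeq"
    using card_of_ordLeq by blast
  ultimately have S: "(card_of ?S, card_of (UNIV :: 'a list set set)) \<in> ordLeq"
    by (rule ordLeq_transitive)
  show ?thesis
    unfolding node_rank_eq[OF assms]
    using ord_Sup_le_iff[OF inf S, of \<beta>] by (auto simp: ordinal_zero_le ord_succ_le_iff[OF inf])
qed


section \<open>Fatou properties\<close>

definition Psi :: "(nat \<Rightarrow> 'a::banach_lattice) \<Rightarrow> 'a list set" where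
  "Psi z = {ys \<in> lists {y. 0 \<le> y \<and> y \<noteq> 0}.
     (\<forall>i < length ys. \<forall>n. norm (pprt (ys ! i - z n)) \<le> norm (ys ! i) / 3 ^ Suc i) \<and>
     (\<forall>i. Suc i < length ys \<longrightarrow> norm (ys ! Suc i - ys ! i) \<le> norm (ys ! i) / 3 ^ Suc i)}"

lemma tree_over_Psi: "tree_over {y. 0 \<le> y \<and> y \<noteq> 0} (Psi z)"
  unfolding tree_over_def Psi_def by (auto simp: prefix_def nth_append in_lists_conv_set split: if_splits)

definition fatou :: "'a::separable_banach_lattice itself \<Rightarrow> 'a list set ordinal \<Rightarrow> bool" where
  "fatou (_ :: 'a itself) \<alpha> \<longleftrightarrow>
     (\<forall>z \<in> (X_down :: (nat \<Rightarrow> 'a) set).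
        isGlb UNIV (range z) 0 \<longleftrightarrow> tree_rank (Psi z) \<le> Fin \<alpha>)"

end

theory Submission
  imports Defs
begin

text \<open>Every implication rests on two properties of the trees \<^const>\<open>Psi\<close>.

  First, for a decreasing positive sequence \<open>z\<close>, the tree \<open>\<Psi>(z)\<close> is well-founded exactly when
  \<open>inf z = 0\<close> (\<open>ill_founded_Psi_iff\<close>). A nonzero positive lower bound gives a constant branch.
  Conversely the increments along a branch are summable relative to norms that cannot shrink below
  half of the first one, so the branch converges to a nonzero vector, and the excess over each
  \<open>z\<^sub>n\<close> vanishes in the limit.

  Secondly, the inequalities that define \<open>\<Psi>(z)\<close> have slack. Replacing every entry of a string by a
  nearby element of a fixed countable set \<open>E\<close> gives a string that satisfies them with three times the
  tolerance (\<open>discretization_Psi\<close>). As the tolerances decrease by the factor \<open>3\<close> from one position to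
  the next, deleting the first entry restores the original ones (\<open>tl_Psi_tol\<close>). Hence questions about
  trees over the uncountable alphabet \<open>X\<^sup>+ - {0}\<close> turn into questions about trees over \<open>E\<close>.

  (3) implies (1): \<open>\<Psi>(z)\<close> is ill-founded if and only if \<open>\<Psi>(z) \<inter> lists E\<close> is, and passing to the
  subtree does not increase the rank. If \<open>X\<close> is \<open>\<alpha>\<close>-Fatou, then \<open>inf z = 0\<close> is equivalent to a bound
  by \<open>\<alpha>\<close> on the rank of the root in this subtree. For countable \<open>\<alpha>\<close> and a countable alphabet such a bound is a
  Borel condition, by recursion on \<open>\<alpha>\<close>.

  (1) implies (2): order convergence asks for a witness \<open>z\<close> in \<^const>\<open>X_down0\<close> subject to countably many
  closed conditions. Borel sets are analytic, and so are their projections along Polish spaces.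

  (2) implies (3): a decreasing positive sequence order converges to \<open>0\<close> exactly when its infimum
  is \<open>0\<close>, so \<^const>\<open>X_down0\<close> is analytic, say \<open>X_down0 = \<phi> ` F\<close> with \<open>F\<close> closed in the Baire space and
  \<open>\<phi>\<close> continuous. Consider the tree \<open>U\<close> of all strings of pairs \<open>(a\<^sub>i, d\<^sub>i)\<close> in which the \<open>a\<^sub>i\<close> begin some
  \<open>a \<in> F\<close> and the \<open>d\<^sub>i \<in> E\<close> form a string of \<open>\<Psi>(\<phi> a)\<close> with tripled tolerance. It is countable. It
  is well-founded, because by closedness and continuity a branch would yield a single \<open>a \<in> F\<close> with
  \<open>\<Psi>(\<phi> a)\<close> ill-founded. So \<open>U\<close> has a countable rank, and by discretization every \<open>\<Psi>(\<phi> a)\<close> embeds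
  into \<open>U\<close> preserving strict extension. This is the boundedness argument behind the Kunen--Martin
  theorem.\<close>

section \<open>Analytic sets\<close>

lemma open_cylinder: "open {b :: nat \<Rightarrow> nat. \<forall>i\<le>k. b i = a i}"
proof -
  have "{b :: nat \<Rightarrow> nat. \<forall>i\<le>k. b i = a i} = (\<Inter>i\<in>{..k}. (\<lambda>b. b i) -` {a i})" by auto
  then show ?thesis
    by (auto intro!: open_INT open_vimage continuous_on_product_coordinates simp: open_discrete)
qed

text \<open>A point of the Baire space is read as a list of requests to move to a point of a dense sequence.
  A request for the \<open>k\<close>-th move is granted only if the move is shorter than \<open>2\<^sup>-\<^sup>k\<close>, so the moves always
  converge, and at a rate that does not depend on the list: this makes the limit continuous.\<close>

lemma continuous_surjection_from_baire:
  "\<exists>g :: (nat \<Rightarrow> nat) \<Rightarrow> 'b::polish_space. continuous_on UNIV g \<and> surj g"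
proof -
  obtain D :: "'b set" where D: "countable D" "\<And>U. open U \<Longrightarrow> U \<noteq> {} \<Longrightarrow> \<exists>d\<in>D. d \<in> U"
    using countable_dense_setE by metis
  have "D \<noteq> {}" using D(2)[of UNIV] by auto
  define d where "d = from_nat_into D"
  have d: "\<exists>k. dist (d k) x < e" if e: "e > 0" for x e
  proof -
    obtain p where "p \<in> D" "p \<in> ball x e"
      using D(2)[OF open_ball, of x e] e by (metis centre_in_ball empty_iff)
    then show ?thesis
      using from_nat_into_surj[OF D(1), of p] unfolding d_def by (auto simp: dist_commute)
  qed
  define y where "y a = rec_nat (d (a 0))
    (\<lambda>k p. if dist (d (a (Suc k))) p < (1/2)^k then d (a (Suc k)) else p)" for a :: "nat \<Rightarrow> nat"
  have y0: "y a 0 = d (a 0)" for a by (simp add: y_def)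
  have yS: "y a (Suc k) = (if dist (d (a (Suc k))) (y a k) < (1/2)^k then d (a (Suc k)) else y a k)"
    for a k by (simp add: y_def)
  have step: "dist (y a (Suc k)) (y a k) \<le> (1/2)^k" for a k
    by (auto simp: yS less_imp_le)
  have near: "dist (y a (k + n)) (y a k) \<le> 2 * (1/2)^k - 2 * (1/2)^(k+n)" for a k n
  proof (induction n)
    case (Suc n)
    have "dist (y a (k + Suc n)) (y a k) \<le> dist (y a (Suc (k + n))) (y a (k+n)) + dist (y a (k+n)) (y a k)"
      using dist_triangle by simp
    then show ?case using Suc step[of a "k+n"] by simp
  qed simp
  have near': "dist (y a m) (y a k) \<le> 2 * (1/2)^k" if "k \<le> m" for a k m
  proof -
    have "dist (y a m) (y a k) \<le> 2 * (1/2)^k - 2 * (1/2)^m"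
      using near[of a k "m - k"] that by simp
    also have "\<dots> \<le> 2 * (1/2)^k" by simp
    finally show ?thesis .
  qed
  have small: "\<exists>k. 4 * (1/2)^k < e" if "e > 0" for e :: real
    using real_arch_pow_inv[of "e/4" "1/2"] that by (auto simp: mult.commute)
  have "Cauchy (y a)" for a
  proof (rule metric_CauchyI)
    fix e :: real assume "e > 0"
    then obtain k where k: "4 * (1/2)^k < e" using small by blast
    have "dist (y a m) (y a n) < e" if "m \<ge> k" "n \<ge> k" for m n
      using dist_triangle2[of "y a m" "y a n" "y a k"] near'[OF that(1), of a] near'[OF that(2), of a] k
      by simp
    then show "\<exists>M. \<forall>m\<ge>M. \<forall>n\<ge>M. dist (y a m) (y a n) < e" by blast
  qed
  then have "\<exists>l. y a \<longlonglongrightarrow> l" for a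
    using Cauchy_convergent convergent_def by blast
  then obtain g where g: "\<And>a. y a \<longlonglongrightarrow> g a" by metis
  have gy: "dist (g a) (y a k) \<le> 2 * (1/2)^k" for a k
  proof -
    have "\<forall>\<^sub>F m in sequentially. dist (y a k) (y a m) \<le> 2 * (1/2)^k"
      unfolding eventually_sequentially using near'[of k _ a] by (metis dist_commute)
    then have "dist (y a k) (g a) \<le> 2 * (1/2)^k"
      by (rule Lim_dist_ubound[OF trivial_limit_sequentially g])
    then show ?thesis by (simp add: dist_commute)
  qed
  have agree: "y b k = y a k" if "\<forall>i\<le>k. b i = a i" for a b k
    using that by (induction k) (auto simp: y0 yS)
  have "continuous_on UNIV g"
    unfolding continuous_on_def tendsto_iff
  proof (intro ballI allI impI)
    fix a :: "nat \<Rightarrow> nat" and e :: real assume "e > 0"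
    then obtain k where k: "4 * (1/2)^k < e" using small by blast
    have "dist (g b) (g a) < e" if "\<forall>i\<le>k. b i = a i" for b
      using dist_triangle2[of "g b" "g a" "y a k"] gy[of b k] gy[of a k] agree[OF that] k by simp
    then show "\<forall>\<^sub>F b in at a within UNIV. dist (g b) (g a) < e"
      unfolding eventually_at_topological using open_cylinder[of k a] by blast
  qed
  moreover have "x \<in> range g" for x
  proof -
    (* With the factor 1/4, consecutive requests are close enough for all of them to be granted. *)
    have "\<exists>j. dist (d j) x < (1/4) * (1/2)^k" for k by (rule d) simp
    then obtain a where a: "\<And>k. dist (d (a k)) x < (1/4) * (1/2)^k" by metis
    have ya: "y a k = d (a k)" for k
    proof (induction k)
      case (Suc k)
      have "0 < (1/2 :: real)^k" by simp
      then have "dist (d (a (Suc k))) (d (a k)) < (1/2)^k"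
        using dist_triangle2[of "d (a (Suc k))" "d (a k)" x] a[of k] a[of "Suc k"]
        unfolding power_Suc by linarith
      then show ?case using Suc by (simp add: yS)
    qed (simp add: y0)
    have "y a \<longlonglongrightarrow> x"
    proof (rule metric_LIMSEQ_I)
      fix e :: real assume "e > 0"
      then obtain k where k: "4 * (1/2)^k < e" using small by blast
      have "dist (y a n) x < e" if "n \<ge> k" for n
      proof -
        have "(1/2::real)^n \<le> (1/2)^k" using that by (intro power_decreasing) auto
        moreover have "0 < (1/2::real)^k" by simp
        ultimately show ?thesis using a[of n] k unfolding ya by linarith
      qed
      then show "\<exists>no. \<forall>n\<ge>no. dist (y a n) x < e" by blast
    qed
    then have "x = g a" using g LIMSEQ_unique by blast
    then show ?thesis by blast
  qed
  ultimately show ?thesis by blast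
qed

lemma analytic_set_closed: "closed A \<Longrightarrow> analytic_set A"
  unfolding analytic_set_def
  by (intro exI[of _ "A \<times> UNIV"]) (auto intro: closed_Times)

lemma continuous_reindex: "continuous_on UNIV (\<lambda>a :: nat \<Rightarrow> nat. \<lambda>n. a (h n))"
  by (intro continuous_on_coordinatewise_then_product continuous_on_product_coordinates)

lemma continuous_reindex_snd:
  "continuous_on UNIV (\<lambda>p :: 'b::topological_space \<times> (nat \<Rightarrow> nat). \<lambda>n. snd p (h n))"
  by (rule continuous_on_compose2[OF continuous_reindex continuous_on_snd[OF continuous_on_id]]) auto

text \<open>One sequence of naturals encodes a witness for each of the countably many sets.\<close>

lemma analytic_set_INT:
  fixes A :: "nat \<Rightarrow> 'b::topological_space set"
  assumes "\<And>k. analytic_set (A k)"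
  shows "analytic_set (\<Inter>k. A k)"
proof -
  obtain C where C: "\<And>k. closed (C k)" "\<And>k. A k = fst ` (C k :: ('b \<times> (nat \<Rightarrow> nat)) set)"
    using assms unfolding analytic_set_def by metis
  define f where "f k p = (fst p, \<lambda>n. snd p (prod_encode (k, n)))"
    for k and p :: "'b \<times> (nat \<Rightarrow> nat)"
  have f: "continuous_on UNIV (f k)" for k
    unfolding f_def
    by (intro continuous_on_Pair continuous_on_fst continuous_on_id continuous_reindex_snd)
  have "closed (\<Inter>k. f k -` C k)"
    by (intro closed_INT ballI closed_vimage C(1) f)
  moreover have "(\<Inter>k. A k) = fst ` (\<Inter>k. f k -` C k)"
  proof (intro set_eqI iffI)
    fix b assume "b \<in> (\<Inter>k. A k)"
    then have "b \<in> fst ` C k" for k using C(2) by blast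
    then have "\<exists>a. (b, a) \<in> C k" for k by (metis imageE prod.collapse)
    then obtain a where a: "\<And>k. (b, a k) \<in> C k" by metis
    define c where "c i = (case prod_decode i of (k, n) \<Rightarrow> a k n)" for i
    have "f k (b, c) = (b, a k)" for k by (simp add: f_def c_def)
    then have "(b, c) \<in> (\<Inter>k. f k -` C k)" using a by simp
    then show "b \<in> fst ` (\<Inter>k. f k -` C k)" by force
  next
    fix b assume "b \<in> fst ` (\<Inter>k. f k -` C k)"
    then obtain c where "(b, c) \<in> (\<Inter>k. f k -` C k)" by auto
    then have c: "f k (b, c) \<in> C k" for k by blast
    have "b \<in> A k" for k
      unfolding C(2) using c[of k] by (force simp: f_def)
    then show "b \<in> (\<Inter>k. A k)" by blast
  qed
  ultimately show ?thesis unfolding analytic_set_def by blast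
qed

text \<open>The first entry of the witness names the set that contains the point, the rest is a witness
  for that set.\<close>

lemma analytic_set_UN:
  fixes A :: "nat \<Rightarrow> 'b::topological_space set"
  assumes "\<And>k. analytic_set (A k)"
  shows "analytic_set (\<Union>k. A k)"
proof -
  obtain C where C: "\<And>k. closed (C k)" "\<And>k. A k = fst ` (C k :: ('b \<times> (nat \<Rightarrow> nat)) set)"
    using assms unfolding analytic_set_def by metis
  define f where "f p = (fst p, \<lambda>n. snd p (Suc n))" for p :: "'b \<times> (nat \<Rightarrow> nat)"
  have f: "continuous_on UNIV f"
    unfolding f_def
    by (intro continuous_on_Pair continuous_on_fst continuous_on_id continuous_reindex_snd)
  have hd: "continuous_on UNIV (\<lambda>p :: 'b \<times> (nat \<Rightarrow> nat). snd p 0)"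
    by (rule continuous_on_compose2[OF continuous_on_product_coordinates
        continuous_on_snd[OF continuous_on_id]]) auto
  (* Written as an intersection over all possible first entries, the condition is visibly closed. *)
  define E where "E = (\<Inter>k. (\<lambda>p. snd p 0) -` (- {k}) \<union> f -` C k)"
  have "closed E" unfolding E_def
    by (intro closed_INT ballI closed_Un closed_vimage C(1) f hd)
      (simp add: closed_def open_discrete)
  moreover have "(\<Union>k. A k) = fst ` E"
  proof (intro set_eqI iffI)
    fix b assume "b \<in> (\<Union>k. A k)"
    then obtain k a where a: "(b, a) \<in> C k" by (auto simp: C(2))
    then have "(b, case_nat k a) \<in> E" by (auto simp: E_def f_def)
    then show "b \<in> fst ` E" by force
  next
    fix b assume "b \<in> fst ` E"
    then obtain a where "(b, a) \<in> E" by auto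
    then have "f (b, a) \<in> C (a 0)" by (auto simp: E_def)
    then show "b \<in> (\<Union>k. A k)" unfolding C(2) by (force simp: f_def)
  qed
  ultimately show ?thesis unfolding analytic_set_def by blast
qed

lemma analytic_set_Int:
  assumes "analytic_set A" "analytic_set B"
  shows "analytic_set (A \<inter> B)"
proof -
  have "A \<inter> B = (\<Inter>k::nat. if k = 0 then A else B)"
    by (auto split: if_splits)
  moreover have "analytic_set (\<Inter>k::nat. if k = 0 then A else B)"
    by (rule analytic_set_INT) (use assms in simp)
  ultimately show ?thesis by simp
qed

lemma analytic_set_vimage:
  fixes f :: "'b::topological_space \<Rightarrow> 'c::topological_space"
  assumes "continuous_on UNIV f" "analytic_set A"
  shows "analytic_set (f -` A)"
proof -
  obtain C :: "('c \<times> (nat \<Rightarrow> nat)) set" where C: "closed C" "A = fst ` C"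
    using assms(2) unfolding analytic_set_def by blast
  let ?h = "\<lambda>p :: 'b \<times> (nat \<Rightarrow> nat). (f (fst p), snd p)"
  have "continuous_on UNIV ?h"
    by (intro continuous_on_Pair continuous_on_snd continuous_on_id
        continuous_on_compose2[OF assms(1) continuous_on_fst[OF continuous_on_id]]) auto
  then have "closed (?h -` C)" using C(1) by (simp add: closed_vimage)
  moreover have "f -` A = fst ` (?h -` C)" unfolding C(2) by (auto simp: image_iff Bex_def)
  ultimately show ?thesis unfolding analytic_set_def by blast
qed

text \<open>The projected coordinate is itself parametrized by the Baire space, so it can be stored in the
  even entries of the witness.\<close>

lemma analytic_set_fst_image:
  fixes A :: "('b::topological_space \<times> 'c::polish_space) set"
  assumes "analytic_set A"
  shows "analytic_set (fst ` A)"
proof -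
  obtain C :: "(('b \<times> 'c) \<times> (nat \<Rightarrow> nat)) set" where C: "closed C" "A = fst ` C"
    using assms unfolding analytic_set_def by blast
  obtain g :: "(nat \<Rightarrow> nat) \<Rightarrow> 'c" where g: "continuous_on UNIV g" "surj g"
    using continuous_surjection_from_baire by blast
  define h where "h p = ((fst p, g (\<lambda>n. snd p (2 * n))), \<lambda>n. snd p (2 * n + 1))"
    for p :: "'b \<times> (nat \<Rightarrow> nat)"
  have h: "continuous_on UNIV h"
    unfolding h_def
    by (intro continuous_on_Pair continuous_on_fst continuous_on_id continuous_reindex_snd
        continuous_on_compose2[OF g(1) continuous_reindex_snd]) auto
  have "closed (h -` C)" using C(1) h by (simp add: closed_vimage)
  moreover have "fst ` A = fst ` (h -` C)"
  proof (intro set_eqI iffI)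
    fix b assume "b \<in> fst ` A"
    then obtain c q where q: "((b, c), q) \<in> C" unfolding C(2) by auto
    obtain p where p: "c = g p" using g(2) by blast
    define r where "r i = (if even i then p (i div 2) else q (i div 2))" for i
    have "h (b, r) = ((b, c), q)" by (simp add: h_def r_def p)
    then show "b \<in> fst ` (h -` C)" using q by force
  next
    fix b assume "b \<in> fst ` (h -` C)"
    then obtain p where "p \<in> h -` C" "b = fst p" by blast
    then have "fst (h p) \<in> A" "b = fst (fst (h p))" unfolding C(2) by (simp_all add: h_def rev_image_eqI)
    then show "b \<in> fst ` A" by blast
  qed
  ultimately show ?thesis unfolding analytic_set_def by blast
qed

text \<open>Here the even entries of a sequence parametrize the point and the odd entries are the witness
  for its membership.\<close>

lemma analytic_set_continuous_image:
  fixes A :: "'b::polish_space set"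
  assumes "analytic_set A"
  obtains F and \<phi> :: "(nat \<Rightarrow> nat) \<Rightarrow> 'b"
  where "closed F" "continuous_on UNIV \<phi>" "A = \<phi> ` F"
proof -
  obtain C :: "('b \<times> (nat \<Rightarrow> nat)) set" where C: "closed C" "A = fst ` C"
    using assms unfolding analytic_set_def by blast
  obtain g :: "(nat \<Rightarrow> nat) \<Rightarrow> 'b" where g: "continuous_on UNIV g" "surj g"
    using continuous_surjection_from_baire by blast
  define \<phi> where "\<phi> r = g (\<lambda>n. r (2 * n))" for r :: "nat \<Rightarrow> nat"
  define h where "h r = (\<phi> r, \<lambda>n. r (2 * n + 1))" for r :: "nat \<Rightarrow> nat"
  have \<phi>: "continuous_on UNIV \<phi>"
    unfolding \<phi>_def by (rule continuous_on_compose2[OF g(1) continuous_reindex]) simp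
  show ?thesis
  proof
    have "continuous_on UNIV h"
      unfolding h_def by (rule continuous_on_Pair[OF \<phi> continuous_reindex])
    then show "closed (h -` C)" using C(1) by (simp add: closed_vimage)
    show "continuous_on UNIV \<phi>" by (rule \<phi>)
    show "A = \<phi> ` (h -` C)"
    proof (intro set_eqI iffI)
      fix b assume "b \<in> A"
      then obtain q where q: "(b, q) \<in> C" unfolding C(2) by auto
      obtain p where p: "b = g p" using g(2) by blast
      define r where "r i = (if even i then p (i div 2) else q (i div 2))" for i
      have "h r = (b, q)" "\<phi> r = b" by (simp_all add: h_def \<phi>_def r_def p)
      then show "b \<in> \<phi> ` (h -` C)" using q by force
    next
      fix b assume "b \<in> \<phi> ` (h -` C)"
      then show "b \<in> A" unfolding C(2) h_def by force
    qed
  qed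
qed

lemma analytic_set_open:
  fixes U :: "'b::metric_space set"
  assumes "open U"
  shows "analytic_set U"
proof (cases "U = UNIV")
  case False
  define K where "K n = (\<lambda>x. infdist x (- U)) -` {inverse (Suc n) ..}" for n
  have "closed (K n)" for n unfolding K_def
    by (intro closed_vimage continuous_intros closed_atLeast)
  then have "analytic_set (\<Union>n. K n)" by (intro analytic_set_UN analytic_set_closed)
  moreover have "x \<in> U \<longleftrightarrow> (\<exists>n. x \<in> K n)" for x
  proof -
    have "x \<in> U \<longleftrightarrow> infdist x (- U) > 0"
      using in_closed_iff_infdist_zero[of "- U" x] assms False infdist_nonneg[of x "- U"]
      by (auto simp: closed_Compl less_le)
    also have "\<dots> \<longleftrightarrow> (\<exists>n. inverse (real (Suc n)) \<le> infdist x (- U))"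
    proof
      assume "0 < infdist x (- U)"
      then show "\<exists>n. inverse (real (Suc n)) \<le> infdist x (- U)"
        using reals_Archimedean[of "infdist x (- U)"] by (auto intro: less_imp_le)
    next
      assume "\<exists>n. inverse (real (Suc n)) \<le> infdist x (- U)"
      then obtain n where "inverse (real (Suc n)) \<le> infdist x (- U)" ..
      moreover have "0 < inverse (real (Suc n))" by simp
      ultimately show "0 < infdist x (- U)" by linarith
    qed
    finally show ?thesis by (simp only: K_def vimage_eq atLeast_iff)
  qed
  ultimately have "U = (\<Union>n. K n)" by blast
  then show ?thesis using \<open>analytic_set (\<Union>n. K n)\<close> by simp
qed (simp add: analytic_set_closed)

text \<open>Analytic sets are not closed under complements, so the induction over the generated
  \<open>\<sigma>\<close>-algebra carries the complement along.\<close>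

lemma borel_imp_analytic:
  fixes A :: "'b::metric_space set"
  assumes "A \<in> sets borel"
  shows "analytic_set A"
proof -
  have "A \<in> sigma_sets UNIV {S. open S}" using assms by (simp add: borel_def)
  then have "analytic_set A \<and> analytic_set (- A)"
  proof induction
    case (Basic a)
    then show ?case by (auto intro: analytic_set_open analytic_set_closed)
  next
    case (Union a)
    have "- (\<Union>i. a i) = (\<Inter>i. - a i)" by blast
    with Union show ?case by (simp only:) (blast intro: analytic_set_UN analytic_set_INT)
  qed (auto simp: analytic_set_closed Compl_eq_Diff_UNIV[symmetric])
  then show ?thesis ..
qed

lemma LIMSEQ_agree_on_initial_segments:
  fixes a :: "nat \<Rightarrow> 'b::topological_space"
  assumes "\<And>n i. i < n \<Longrightarrow> X n i = a i"
  shows "X \<longlonglongrightarrow> a"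
proof -
  have "\<forall>\<^sub>F n in sequentially. X n i = a i" for i
    using assms unfolding eventually_sequentially by (metis Suc_le_eq)
  then have "((\<lambda>n. X n i) \<longlongrightarrow> a i) sequentially" for i by (rule tendsto_eventually)
  then have "limitin (product_topology (\<lambda>i. euclidean) UNIV) X a sequentially"
    unfolding limitin_componentwise by simp
  then show ?thesis by (simp only: euclidean_product_topology limitin_canonical_iff)
qed

section \<open>Countable ranks\<close>

text \<open>The least strict bound of \<open>S\<close> has only countably many predecessors, since each of them is below
  or equal to a member of \<open>S\<close>.\<close>

lemma countable_bounded_below_omega1:
  fixes S :: "'u ordinal set"
  assumes u: "uncountable (UNIV :: 'u set)" and S: "countable S" "S \<subseteq> {..<omega1}"
  obtains \<beta> where "\<beta> < omega1" "\<forall>\<alpha>\<in>S. \<alpha> < \<beta>"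
proof -
  have inf: "infinite (UNIV :: 'u set)" using u countable_finite by blast
  then obtain f :: "nat \<Rightarrow> 'u" where f: "inj f" using infinite_countable_subset by blast
  have "inj_on (\<lambda>x. f (to_nat_on S x)) S"
    using f inj_on_to_nat_on[OF S(1)] by (auto simp: inj_on_def)
  then have "(card_of S, card_of (UNIV :: 'u set)) \<in> ordLeq"
    using card_of_ordLeq by blast
  then have ex: "\<exists>\<beta>. \<forall>\<alpha>\<in>S. \<alpha> < \<beta>" by (rule ordinal_bounded[OF inf])
  define \<beta> where "\<beta> = (LEAST \<beta>. \<forall>\<alpha>\<in>S. \<alpha> < \<beta>)"
  have \<beta>: "\<forall>\<alpha>\<in>S. \<alpha> < \<beta>" unfolding \<beta>_def by (rule LeastI_ex[OF ex])
  have "{..<\<beta>} \<subseteq> (\<Union>\<alpha>\<in>S. insert \<alpha> {..<\<alpha>})"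
  proof
    fix \<gamma> assume "\<gamma> \<in> {..<\<beta>}"
    then have "\<not> (\<forall>\<alpha>\<in>S. \<alpha> < \<gamma>)" unfolding \<beta>_def using not_less_Least by blast
    then obtain \<alpha> where "\<alpha> \<in> S" "\<gamma> \<le> \<alpha>" by (auto simp: not_less)
    then show "\<gamma> \<in> (\<Union>\<alpha>\<in>S. insert \<alpha> {..<\<alpha>})" by (auto simp: le_less)
  qed
  moreover have "countable {..<\<alpha>}" if "\<alpha> \<in> S" for \<alpha>
    using less_omega1_iff[OF u, of \<alpha>] S(2) that by blast
  then have "countable (\<Union>\<alpha>\<in>S. insert \<alpha> {..<\<alpha>})" using S(1) by blast
  ultimately have "countable {..<\<beta>}" by (rule countable_subset)
  then have "\<beta> < omega1" using less_omega1_iff[OF u] by blast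
  then show thesis using \<beta> that by blast
qed

text \<open>The ordinals are taken over an arbitrary uncountable type that need not be related to
  the domain of \<open>R\<close>, so that ranks of trees over different alphabets can be compared.\<close>

lemma countable_wf_rank:
  fixes R :: "('x \<times> 'x) set"
  assumes u: "uncountable (UNIV :: 'u set)"
    and wf: "wf R" and R: "\<And>y. countable {x. (x, y) \<in> R}"
  obtains r :: "'x \<Rightarrow> 'u ordinal"
  where "\<And>x. r x < omega1" "\<And>x y. (x, y) \<in> R \<Longrightarrow> r x < r y"
proof -
  define r :: "'x \<Rightarrow> 'u ordinal"
    where "r = wfrec R (\<lambda>r y. LEAST \<beta>. \<forall>x. (x, y) \<in> R \<longrightarrow> r x < \<beta>)"
  have "adm_wf R (\<lambda>r y. LEAST \<beta>. \<forall>x. (x, y) \<in> R \<longrightarrow> (r x :: 'u ordinal) < \<beta>)"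
    unfolding adm_wf_def
  proof (intro allI impI)
    fix f g :: "'x \<Rightarrow> 'u ordinal" and y assume "\<forall>x. (x, y) \<in> R \<longrightarrow> f x = g x"
    then have "(\<forall>x. (x, y) \<in> R \<longrightarrow> f x < \<beta>) = (\<forall>x. (x, y) \<in> R \<longrightarrow> g x < \<beta>)" for \<beta> by auto
    then show "(LEAST \<beta>. \<forall>x. (x, y) \<in> R \<longrightarrow> f x < \<beta>) = (LEAST \<beta>. \<forall>x. (x, y) \<in> R \<longrightarrow> g x < \<beta>)"
      by simp
  qed
  then have r: "r y = (LEAST \<beta>. \<forall>x. (x, y) \<in> R \<longrightarrow> r x < \<beta>)" for y
    unfolding r_def by (subst wfrec_fixpoint[OF wf]) auto
  have bd: "\<exists>\<beta>. \<beta> < omega1 \<and> (\<forall>x. (x, y) \<in> R \<longrightarrow> r x < \<beta>)"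
    if "\<And>x. (x, y) \<in> R \<Longrightarrow> r x < omega1" for y
  proof -
    have "countable (r ` {x. (x, y) \<in> R})" "r ` {x. (x, y) \<in> R} \<subseteq> {..<omega1}"
      using R that by auto
    then show ?thesis
      using countable_bounded_below_omega1[OF u] by (metis image_eqI mem_Collect_eq)
  qed
  have lt: "r y < omega1" for y
    using wf
  proof (induction y rule: wf_induct_rule)
    case (less y)
    then obtain \<beta> where "\<beta> < omega1" "\<forall>x. (x, y) \<in> R \<longrightarrow> r x < \<beta>" using bd by blast
    moreover have "r y \<le> \<beta>" unfolding r[of y] by (rule Least_le) (use calculation in blast)
    ultimately show ?case by simp
  qed
  moreover have "r x < r y" if "(x, y) \<in> R" for x y
  proof -
    have "\<exists>\<beta>. \<forall>x. (x, y) \<in> R \<longrightarrow> r x < \<beta>" using bd lt by blast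
    then have "\<forall>x. (x, y) \<in> R \<longrightarrow> r x < r y" unfolding r[of y] by (rule LeastI_ex)
    then show ?thesis using that by blast
  qed
  ultimately show thesis using that by blast
qed

lemma tree_rank_le_Fin_iff:
  fixes T :: "'a list set"
  shows "tree_rank T \<le> Fin \<alpha> \<longleftrightarrow> \<not> ill_founded T \<and> node_rank T [] < \<alpha>"
proof -
  have "infinite (UNIV :: 'a list set set)"
    using uncountable_list_set countable_finite by blast
  then show ?thesis by (simp add: tree_rank_def ord_succ_le_iff)
qed

text \<open>This bounds the rank of the node \<open>s\<close>. In contrast to a comparison with \<^const>\<open>node_rank\<close>,
  this recursion is meaningful for ill-founded \<open>T\<close> as well, and it unfolds into countably many
  Boolean operations when \<open>\<beta>\<close> is a countable ordinal and \<open>T\<close> consists of strings from a countable set.\<close>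

function rank_le :: "'a list set \<Rightarrow> 'u ordinal \<Rightarrow> 'a list \<Rightarrow> bool" where
  "rank_le T \<beta> s \<longleftrightarrow> (\<forall>t\<in>T. strict_prefix s t \<longrightarrow> (\<exists>\<gamma>\<in>{..<\<beta>}. rank_le T \<gamma> t))"
  by auto
termination
  by (relation "inv_image {(\<alpha>, \<beta>). \<alpha> < \<beta>} (\<lambda>(T, \<beta>, s). \<beta>)") (auto simp: wf)

declare rank_le.simps [simp del]

lemma rank_le_node_rank:
  assumes T: "tree_over \<Sigma> T" "\<not> ill_founded T" and T': "T' \<subseteq> T"
  shows "s \<in> T \<Longrightarrow> node_rank T s \<le> \<beta> \<Longrightarrow> rank_le T' \<beta> s"
proof (induction \<beta> arbitrary: s rule: less_induct)
  case (less \<beta>)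
  have "rank_le T' (node_rank T t) t \<and> node_rank T t < \<beta>" if t: "t \<in> T'" "strict_prefix s t" for t
  proof
    show lt: "node_rank T t < \<beta>"
      using less.prems(2) t T' unfolding node_rank_le_iff[OF T less.prems(1)] by blast
    show "rank_le T' (node_rank T t) t"
      by (rule less.IH[OF lt _ order_refl]) (use t T' in blast)
  qed
  then show ?case by (subst rank_le.simps) blast
qed

text \<open>Along a branch the bound would decrease strictly for ever.\<close>

lemma rank_le_not_branch:
  assumes "\<And>n. map y [0..<n] \<in> T"
  shows "\<not> rank_le T \<beta> (map y [0..<k])"
proof (induction \<beta> arbitrary: k rule: less_induct)
  case (less \<beta>)
  have "strict_prefix (map y [0..<k]) (map y [0..<Suc k])" by (simp add: strict_prefix_def)
  then show ?case using less assms[of "Suc k"] by (subst rank_le.simps) blast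
qed

lemma rank_le_borel:
  fixes T :: "'z::topological_space \<Rightarrow> 'a list set"
  assumes u: "uncountable (UNIV :: 'u set)" and L: "countable L" "\<And>z. T z \<subseteq> L"
    and T: "\<And>s. {z. s \<in> T z} \<in> sets borel"
  shows "(\<beta> :: 'u ordinal) < omega1 \<Longrightarrow> {z. rank_le (T z) \<beta> s} \<in> sets borel"
proof (induction \<beta> arbitrary: s rule: less_induct)
  case (less \<beta>)
  have eq: "{z. rank_le (T z) \<beta> s} =
      (\<Inter>t\<in>{t\<in>L. strict_prefix s t}. - {z. t \<in> T z} \<union> (\<Union>\<gamma>\<in>{..<\<beta>}. {z. rank_le (T z) \<gamma> t}))"
    using L(2) by (subst rank_le.simps) blast
  have "countable {..<\<beta>}" using less.prems less_omega1_iff[OF u] by blast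
  moreover have "{z. rank_le (T z) \<gamma> t} \<in> sets borel" if "\<gamma> \<in> {..<\<beta>}" for \<gamma> t
    using less.IH[of \<gamma>] that less.prems by simp
  ultimately have "(\<Union>\<gamma>\<in>{..<\<beta>}. {z. rank_le (T z) \<gamma> t}) \<in> sets borel" for t
    by (intro sets.countable_UN') auto
  moreover have "- {z. t \<in> T z} \<in> sets borel" for t
    using T[of t] sets.compl_sets[of "{z. t \<in> T z}" borel] by (simp add: Compl_eq_Diff_UNIV)
  moreover have "countable {t \<in> L. strict_prefix s t}"
    using L(1) by (rule countable_subset[rotated]) blast
  ultimately show ?case unfolding eq by (intro sets.countable_INT'' sets.Un) auto
qed

section \<open>Continuity and order in a Banach lattice\<close>

lemma norm_pprt_diff_le:
  fixes x y :: "'a::banach_lattice"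
  shows "norm (pprt x - pprt y) \<le> norm (x - y)"
proof (rule norm_mono_abs)
  have le: "pprt u \<le> pprt v + \<bar>u - v\<bar>" for u v :: 'a
    unfolding pprt_def[of u]
  proof (rule sup_least)
    have "u = v + (u - v)" by simp
    also have "\<dots> \<le> pprt v + \<bar>u - v\<bar>"
      by (rule add_mono) (simp_all add: pprt_def abs_ge_self)
    finally show "u \<le> pprt v + \<bar>u - v\<bar>" .
    show "0 \<le> pprt v + \<bar>u - v\<bar>" by (rule add_nonneg_nonneg) simp_all
  qed
  show "\<bar>pprt x - pprt y\<bar> \<le> \<bar>x - y\<bar>"
    using le[of x y] le[of y x] by (intro abs_leI) (simp_all add: algebra_simps abs_minus_commute)
qed

lemma continuous_on_pprt:
  fixes f :: "'b::topological_space \<Rightarrow> 'a::banach_lattice"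
  assumes "continuous_on S f"
  shows "continuous_on S (\<lambda>x. pprt (f x))"
proof -
  have "continuous_on UNIV (pprt :: 'a \<Rightarrow> 'a)"
    unfolding continuous_on_iff
    by (metis dist_norm norm_pprt_diff_le order_le_less_trans)
  then show ?thesis using assms by (rule continuous_on_compose2) simp
qed

lemma pprt_diff_eq_0_iff: "pprt (x - y) = 0 \<longleftrightarrow> x \<le> (y :: 'a::banach_lattice)"
  by (simp flip: le_zero_iff_zero_pprt)

lemma closed_Collect_le_lattice:
  fixes f g :: "'b::topological_space \<Rightarrow> 'a::banach_lattice"
  assumes "continuous_on UNIV f" "continuous_on UNIV g"
  shows "closed {x. f x \<le> g x}"
proof -
  have "{x. f x \<le> g x} = (\<lambda>x. pprt (f x - g x)) -` {0}" by (auto simp: pprt_diff_eq_0_iff)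
  then show ?thesis
    by (simp add: closed_vimage continuous_on_pprt continuous_on_diff assms)
qed

lemma continuous_on_abs_lattice:
  fixes f :: "'b::topological_space \<Rightarrow> 'a::banach_lattice"
  assumes "continuous_on S f"
  shows "continuous_on S (\<lambda>x. \<bar>f x\<bar>)"
proof -
  have eq: "(\<lambda>x. \<bar>f x\<bar>) = (\<lambda>x. pprt (f x) + pprt (- f x))"
    by (simp add: abs_prts pprt_neg)
  show ?thesis
    unfolding eq by (intro continuous_on_add continuous_on_pprt continuous_on_minus assms)
qed

lemma isGlb_zero_iff:
  fixes z :: "nat \<Rightarrow> 'a::banach_lattice"
  shows "isGlb UNIV (range z) 0 \<longleftrightarrow> (\<forall>n. 0 \<le> z n) \<and> (\<forall>l. (\<forall>n. l \<le> z n) \<longrightarrow> l \<le> 0)"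
  by (auto simp: isGlb_def greatestP_def isLb_def setge_def setle_def)

lemma isGlb_zero_iff_no_positive_lower_bound:
  fixes z :: "nat \<Rightarrow> 'a::banach_lattice"
  assumes "z \<in> X_down"
  shows "isGlb UNIV (range z) 0 \<longleftrightarrow> \<not> (\<exists>l. 0 \<le> l \<and> l \<noteq> 0 \<and> (\<forall>n. l \<le> z n))"
proof -
  have z: "0 \<le> z n" for n using assms by (simp add: X_down_def)
  have "l \<le> 0" if no: "\<not> (\<exists>l. 0 \<le> l \<and> l \<noteq> 0 \<and> (\<forall>n. l \<le> z n))" and l: "\<forall>n. l \<le> z n" for l
  proof -
    have "pprt l \<le> z n" for n using z l by (simp add: pprt_def)
    then have "pprt l = 0" using no zero_le_pprt[of l] by blast
    then show ?thesis by (simp add: le_zero_iff_zero_pprt)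
  qed
  then show ?thesis unfolding isGlb_zero_iff using z order_antisym by blast
qed

lemma X_down_closed: "closed (X_down :: (nat \<Rightarrow> 'a::banach_lattice) set)"
proof -
  have eq: "X_down = (\<Inter>m. \<Inter>n\<in>{m..}. {z :: nat \<Rightarrow> 'a. z n \<le> z m}) \<inter> (\<Inter>n. {z. 0 \<le> z n})"
    by (auto simp: X_down_def decseq_def)
  have "closed {z :: nat \<Rightarrow> 'a. z n \<le> z m}" "closed {z :: nat \<Rightarrow> 'a. 0 \<le> z n}" for m n
    by (intro closed_Collect_le_lattice continuous_on_const continuous_on_product_coordinates)+
  then show ?thesis unfolding eq by (intro closed_Int closed_INT ballI)
qed

text \<open>Such a sequence can serve as its own dominating sequence; and a lower bound of it is below
  every term of any dominating sequence.\<close>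

lemma sigma_order_converges_zero_iff:
  fixes z :: "nat \<Rightarrow> 'a::banach_lattice"
  assumes "z \<in> X_down"
  shows "sigma_order_converges z 0 \<longleftrightarrow> isGlb UNIV (range z) 0"
proof
  have z: "decseq z" "0 \<le> z n" for n using assms by (auto simp: X_down_def)
  show "isGlb UNIV (range z) 0" if conv: "sigma_order_converges z 0"
  proof -
    obtain w :: "nat \<Rightarrow> 'a" where w: "isGlb UNIV (range w) 0" "\<forall>m. \<forall>\<^sub>F n in sequentially. \<bar>z n - 0\<bar> \<le> w m"
      using conv unfolding sigma_order_converges_def by blast
    have "l \<le> 0" if l: "\<forall>n. l \<le> z n" for l
    proof -
      have "l \<le> w m" for m
      proof -
        obtain n where "\<bar>z n - 0\<bar> \<le> w m"
          using w(2) eventually_happens[of "\<lambda>n. \<bar>z n - 0\<bar> \<le> w m"] trivial_limit_sequentially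
          by blast
        then have "z n \<le> w m" using z(2)[of n] by simp
        then show ?thesis using l order_trans by blast
      qed
      then show ?thesis using w(1) unfolding isGlb_zero_iff by blast
    qed
    then show ?thesis unfolding isGlb_zero_iff using z by blast
  qed
  have "\<forall>\<^sub>F n in sequentially. \<bar>z n - 0\<bar> \<le> z m" for m
    using decseqD[OF z(1)] z(2) by (auto simp: eventually_sequentially)
  then show "sigma_order_converges z 0" if "isGlb UNIV (range z) 0"
    unfolding sigma_order_converges_def using that z(1) by blast
qed

section \<open>The trees \<open>\<Psi>(z)\<close>\<close>

text \<open>Strings chosen from a countable set can only approximate those of \<^const>\<open>Psi\<close>, so the tolerance
  in the defining inequalities has to be variable.\<close>

definition Psi_tol :: "real \<Rightarrow> (nat \<Rightarrow> 'a::banach_lattice) \<Rightarrow> 'a list set" where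
  "Psi_tol c z = {ys \<in> lists {y. 0 \<le> y \<and> y \<noteq> 0}.
     (\<forall>i < length ys. \<forall>n. norm (pprt (ys ! i - z n)) \<le> c * norm (ys ! i) / 3 ^ Suc i) \<and>
     (\<forall>i. Suc i < length ys \<longrightarrow> norm (ys ! Suc i - ys ! i) \<le> c * norm (ys ! i) / 3 ^ Suc i)}"

lemma Psi_eq_Psi_tol: "Psi z = Psi_tol 1 z"
  by (simp add: Psi_def Psi_tol_def)

lemma Psi_tol_iff:
  "ys \<in> Psi_tol c z \<longleftrightarrow>
     (\<forall>i < length ys. 0 \<le> ys ! i \<and> ys ! i \<noteq> 0 \<and>
       (\<forall>n. norm (pprt (ys ! i - z n)) \<le> c * norm (ys ! i) / 3 ^ Suc i)) \<and>
     (\<forall>i. Suc i < length ys \<longrightarrow> norm (ys ! Suc i - ys ! i) \<le> c * norm (ys ! i) / 3 ^ Suc i)"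
  unfolding Psi_tol_def by (auto simp: in_lists_conv_set all_set_conv_all_nth)

lemma closed_Psi_tol: "closed {z. ys \<in> Psi_tol c z}"
proof -
  have eq: "{z. ys \<in> Psi_tol c z} =
      {z. \<forall>i < length ys. 0 \<le> ys ! i \<and> ys ! i \<noteq> 0} \<inter>
      {z. \<forall>i. Suc i < length ys \<longrightarrow> norm (ys ! Suc i - ys ! i) \<le> c * norm (ys ! i) / 3 ^ Suc i} \<inter>
      (\<Inter>i\<in>{..<length ys}. \<Inter>n.
        (\<lambda>z. norm (pprt (ys ! i - z n))) -` {.. c * norm (ys ! i) / 3 ^ Suc i})"
    by (auto simp: Psi_tol_iff)
  have "closed ((\<lambda>z. norm (pprt (ys ! i - z n))) -` {.. c * norm (ys ! i) / 3 ^ Suc i})"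
    for i n
    by (intro closed_vimage closed_atMost continuous_on_norm continuous_on_pprt continuous_on_diff
        continuous_on_const continuous_on_product_coordinates)
  then show ?thesis
    unfolding eq by (intro closed_Int closed_INT ballI closed_Collect_const)
qed

lemma branch_Psi_tol_iff:
  "(\<forall>k. map y [0..<k] \<in> Psi_tol c z) \<longleftrightarrow>
     (\<forall>i. 0 \<le> y i \<and> y i \<noteq> 0 \<and> (\<forall>n. norm (pprt (y i - z n)) \<le> c * norm (y i) / 3 ^ Suc i) \<and>
        norm (y (Suc i) - y i) \<le> c * norm (y i) / 3 ^ Suc i)"
proof
  assume L: "\<forall>k. map y [0..<k] \<in> Psi_tol c z"
  show "\<forall>i. 0 \<le> y i \<and> y i \<noteq> 0 \<and> (\<forall>n. norm (pprt (y i - z n)) \<le> c * norm (y i) / 3 ^ Suc i) \<and>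
        norm (y (Suc i) - y i) \<le> c * norm (y i) / 3 ^ Suc i"
  proof
    fix i
    have nth: "map y [0..<Suc (Suc i)] ! i = y i" "map y [0..<Suc (Suc i)] ! Suc i = y (Suc i)"
      and len: "i < length (map y [0..<Suc (Suc i)])" "Suc i < length (map y [0..<Suc (Suc i)])"
      by (simp_all del: upt_Suc)
    have "map y [0..<Suc (Suc i)] \<in> Psi_tol c z" using L by blast
    then show "0 \<le> y i \<and> y i \<noteq> 0 \<and> (\<forall>n. norm (pprt (y i - z n)) \<le> c * norm (y i) / 3 ^ Suc i) \<and>
        norm (y (Suc i) - y i) \<le> c * norm (y i) / 3 ^ Suc i"
      unfolding Psi_tol_iff using len nth by metis
  qed
qed (simp add: Psi_tol_iff)

text \<open>The relative increments of a branch are at most \<open>3\<^sup>-\<^sup>1, 3\<^sup>-\<^sup>2, \<dots>\<close>, and the product of the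
  factors \<open>1 - 3\<^sup>-\<^sup>i\<close> is at least \<open>1/2\<close>. So the branch is a Cauchy sequence that stays away from \<open>0\<close>, and
  its limit is the required lower bound.\<close>

lemma branch_Psi_limit:
  fixes y :: "nat \<Rightarrow> 'a::banach_lattice"
  assumes "\<And>k. map y [0..<k] \<in> Psi z"
  shows "\<exists>l. 0 \<le> l \<and> l \<noteq> 0 \<and> (\<forall>n. l \<le> z n)"
proof -
  have y: "0 \<le> y i" "y i \<noteq> 0" "norm (pprt (y i - z n)) \<le> norm (y i) / 3 ^ Suc i"
    "norm (y (Suc i) - y i) \<le> norm (y i) / 3 ^ Suc i" for i n
    using assms branch_Psi_tol_iff[of y 1 z] by (auto simp: Psi_eq_Psi_tol)
  define t :: "nat \<Rightarrow> real" where "t i = 1 / 3 ^ i" for i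
  have t: "0 < t i" "t i \<le> 1" "t (Suc i) = t i / 3" for i
    by (simp_all add: t_def)
  define N where "N = norm (y 0)"
  have N: "N > 0" using y(2) by (simp add: N_def)
  have tt: "t i * t i \<le> t i" for i using t[of i] by (simp add: mult_le_cancel_left1)
  (* The terms in t i make these two bounds strong enough for the inductions to go through. *)
  have up: "norm (y i) \<le> (2 - t i) * N" for i
  proof (induction i)
    case (Suc i)
    have "norm (y (Suc i)) \<le> norm (y i) + norm (y i) / 3 ^ Suc i"
      using norm_triangle_ineq2[of "y (Suc i)" "y i"] y(4)[of i] by linarith
    also have "\<dots> = norm (y i) * (1 + t i / 3)" by (simp add: t_def field_simps)
    also have "\<dots> \<le> (2 - t i) * N * (1 + t i / 3)"
      by (rule mult_right_mono[OF Suc]) (use t(1)[of i] in simp)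
    also have "\<dots> = ((2 - t i) * (1 + t i / 3)) * N" by simp
    also have "\<dots> \<le> (2 - t (Suc i)) * N"
      by (rule mult_right_mono) (use N t(1)[of i] in \<open>auto simp: t(3) algebra_simps\<close>)
    finally show ?case .
  qed (simp add: N_def t_def)
  have low: "(1 / 2 + t i / 2) * N \<le> norm (y i)" for i
  proof (induction i)
    case (Suc i)
    have "(1 / 2 + t (Suc i) / 2) * N \<le> ((1 / 2 + t i / 2) * (1 - t i / 3)) * N"
      by (rule mult_right_mono) (use N tt[of i] in \<open>auto simp: t(3) algebra_simps\<close>)
    also have "\<dots> = (1 / 2 + t i / 2) * N * (1 - t i / 3)" by simp
    also have "\<dots> \<le> norm (y i) * (1 - t i / 3)"
      by (rule mult_right_mono[OF Suc]) (use t(2)[of i] in simp)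
    also have "\<dots> = norm (y i) - norm (y i) / 3 ^ Suc i" by (simp add: t_def field_simps)
    also have "\<dots> \<le> norm (y (Suc i))"
      using norm_triangle_ineq2[of "y i" "y (Suc i)"] y(4)[of i] by (simp add: norm_minus_commute)
    finally show ?case .
  qed (simp add: N_def t_def)
  have bound: "norm (y i) / 3 ^ Suc i \<le> 2 * N * (1 / 3) ^ i" for i
  proof -
    have "norm (y i) \<le> 2 * N" using up[of i] mult_pos_pos[OF t(1)[of i] N] by (simp add: algebra_simps)
    then have "norm (y i) * t (Suc i) \<le> 2 * N * t i"
      using t[of i] N by (intro mult_mono) auto
    then show ?thesis by (simp add: t_def power_one_over)
  qed
  have geo: "summable (\<lambda>i. 2 * N * (1 / 3) ^ i)" by (intro summable_mult summable_geometric) simp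
  have "summable (\<lambda>i. y (Suc i) - y i)"
    by (rule summable_comparison_test'[OF geo, of 0]) (use y(4) bound order_trans in blast)
  then have "convergent (\<lambda>n. \<Sum>i<n. y (Suc i) - y i)" by (simp add: summable_iff_convergent)
  then obtain s where "(\<lambda>n. y n - y 0) \<longlonglongrightarrow> s"
    unfolding convergent_def sum_lessThan_telescope by blast
  from tendsto_add[OF this tendsto_const[of "y 0"]]
  have lim: "y \<longlonglongrightarrow> s + y 0" by simp
  define l where "l = s + y 0"
  have l: "y \<longlonglongrightarrow> l" using lim by (simp add: l_def)
  have "N / 2 \<le> norm l"
  proof (rule LIMSEQ_le_const[OF tendsto_norm[OF l]])
    have "N / 2 \<le> norm (y i)" for i
      using low[of i] mult_pos_pos[OF t(1)[of i] N] by (simp add: algebra_simps)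
    then show "\<exists>K. \<forall>n\<ge>K. N / 2 \<le> norm (y n)" by blast
  qed
  then have "l \<noteq> 0" using N by auto
  moreover have "0 \<le> l"
  proof -
    have "closed {x :: 'a. 0 \<le> x}"
      by (intro closed_Collect_le_lattice continuous_on_const continuous_on_id)
    then show ?thesis using closed_sequentially[of "{x. 0 \<le> x}" y l] y(1) l by simp
  qed
  moreover have "l \<le> z n" for n
  proof -
    have "continuous_on UNIV (\<lambda>x. pprt (x - z n))"
      by (intro continuous_on_pprt continuous_on_diff continuous_on_id continuous_on_const)
    then have "(\<lambda>i. pprt (y i - z n)) \<longlonglongrightarrow> pprt (l - z n)"
      by (rule continuous_on_tendsto_compose[OF _ l]) simp_all
    moreover have "(\<lambda>i. pprt (y i - z n)) \<longlonglongrightarrow> 0"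
    proof (rule Lim_null_comparison)
      show "\<forall>\<^sub>F i in sequentially. norm (pprt (y i - z n)) \<le> 2 * N * (1 / 3) ^ i"
        using y(3) bound order_trans by (intro always_eventually) blast
      show "(\<lambda>i. 2 * N * (1 / 3) ^ i) \<longlonglongrightarrow> 0" using summable_LIMSEQ_zero[OF geo] .
    qed
    ultimately show ?thesis using LIMSEQ_unique pprt_diff_eq_0_iff by metis
  qed
  ultimately show ?thesis by blast
qed

lemma constant_branch_Psi:
  fixes z :: "nat \<Rightarrow> 'a::banach_lattice"
  assumes "0 \<le> l" "l \<noteq> 0" "\<And>n. l \<le> z n"
  shows "map (\<lambda>_. l) [0..<k] \<in> Psi z"
proof -
  have "pprt (l - z n) = 0" for n using assms(3) by (simp add: pprt_diff_eq_0_iff)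
  then have "\<forall>k. map (\<lambda>_. l) [0..<k] \<in> Psi_tol 1 z"
    unfolding branch_Psi_tol_iff using assms by simp
  then show ?thesis unfolding Psi_eq_Psi_tol by blast
qed

lemma ill_founded_Psi_iff:
  fixes z :: "nat \<Rightarrow> 'a::banach_lattice"
  assumes "z \<in> X_down"
  shows "ill_founded (Psi z) \<longleftrightarrow> \<not> isGlb UNIV (range z) 0"
  unfolding isGlb_zero_iff_no_positive_lower_bound[OF assms] not_not
proof
  assume "ill_founded (Psi z)"
  then show "\<exists>l. 0 \<le> l \<and> l \<noteq> 0 \<and> (\<forall>n. l \<le> z n)"
    unfolding ill_founded_def using branch_Psi_limit by blast
next
  assume "\<exists>l. 0 \<le> l \<and> l \<noteq> 0 \<and> (\<forall>n. l \<le> z n)"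
  then obtain l where l: "0 \<le> l" "l \<noteq> 0" "\<And>n. l \<le> z n" by blast
  have "map (\<lambda>_. l) [0..<k] \<in> Psi z" for k
    by (rule constant_branch_Psi[OF l])
  then show "ill_founded (Psi z)" unfolding ill_founded_def by blast
qed

lemma X_down0_iff_well_founded:
  "z \<in> X_down0 \<longleftrightarrow> z \<in> X_down \<and> \<not> ill_founded (Psi z)"
  unfolding X_down0_def using ill_founded_Psi_iff[of z] by blast

text \<open>The map \<open>\<delta> i\<close> rounds a nonzero positive vector to an element of \<open>E\<close>, with a relative error of a
  quarter of the tolerance at position \<open>i\<close>.\<close>

definition approximation_scheme :: "'a::banach_lattice set \<Rightarrow> (nat \<Rightarrow> 'a \<Rightarrow> 'a) \<Rightarrow> bool" where
  "approximation_scheme E \<delta> \<longleftrightarrow> (\<forall>i y. 0 \<le> y \<longrightarrow> y \<noteq> 0 \<longrightarrow>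
     \<delta> i y \<in> E \<and> 0 \<le> \<delta> i y \<and> \<delta> i y \<noteq> 0 \<and> norm (\<delta> i y - y) \<le> norm y / (4 * 3 ^ Suc i))"

text \<open>The positive parts of a dense set are dense in the positive cone, because taking positive
  parts does not increase distances.\<close>

lemma approximation_scheme_exists:
  "\<exists>(E :: 'a::separable_banach_lattice set) \<delta>. countable E \<and> approximation_scheme E \<delta>"
proof -
  obtain D :: "'a set" where D: "countable D" "\<And>U. open U \<Longrightarrow> U \<noteq> {} \<Longrightarrow> \<exists>d\<in>D. d \<in> U"
    using countable_dense_setE by metis
  have ex: "\<exists>d. d \<in> pprt ` D \<and> 0 \<le> d \<and> d \<noteq> 0 \<and> norm (d - y) \<le> norm y / (4 * 3 ^ Suc i)"
    if y: "0 \<le> y" "y \<noteq> 0" for i and y :: 'a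
  proof -
    have e: "0 < norm y / (4 * 3 ^ Suc i)" using y by simp
    have "ball y (norm y / (4 * 3 ^ Suc i)) \<noteq> {}" using e by (metis centre_in_ball empty_iff)
    then obtain d where d: "d \<in> D" "d \<in> ball y (norm y / (4 * 3 ^ Suc i))"
      using D(2)[OF open_ball] by blast
    have "norm (pprt d - y) = norm (pprt d - pprt y)" using y by simp
    also have "\<dots> \<le> norm (d - y)" by (rule norm_pprt_diff_le)
    also have lt: "\<dots> < norm y / (4 * 3 ^ Suc i)" using d(2) by (simp add: dist_norm norm_minus_commute)
    finally have lt: "norm (pprt d - y) < norm y / (4 * 3 ^ Suc i)" .
    have "1 \<le> 4 * (3::real) ^ Suc i" using one_le_power[of "3::real" "Suc i"] by simp
    then have "norm y / (4 * 3 ^ Suc i) \<le> norm y"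
      using divide_left_mono[of 1 "4 * (3::real) ^ Suc i" "norm y"] by simp
    then have "pprt d \<noteq> 0" using lt by auto
    then show ?thesis using d(1) lt by (intro exI[of _ "pprt d"]) auto
  qed
  define \<delta> where "\<delta> i y = (SOME d. d \<in> pprt ` D \<and> 0 \<le> d \<and> d \<noteq> 0 \<and>
    norm (d - y) \<le> norm y / (4 * 3 ^ Suc i))" for i and y :: 'a
  have "\<delta> i y \<in> pprt ` D \<and> 0 \<le> \<delta> i y \<and> \<delta> i y \<noteq> 0 \<and>
    norm (\<delta> i y - y) \<le> norm y / (4 * 3 ^ Suc i)" if "0 \<le> y" "y \<noteq> 0" for i y
    unfolding \<delta>_def by (rule someI_ex[OF ex[OF that]])
  then have "approximation_scheme (pprt ` D) \<delta>" by (simp add: approximation_scheme_def)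
  moreover have "countable (pprt ` D)" using D(1) by simp
  ultimately show ?thesis by blast
qed

text \<open>With \<open>t = 3\<^sup>-\<^sup>(\<^sup>i\<^sup>+\<^sup>1\<^sup>) \<le> 1/3\<close>, rounding keeps at least \<open>11/12\<close> of the norm of the entry \<open>y\<close> at position \<open>i\<close>,
  so the tripled tolerance is at least \<open>11/4 t \<parallel>y\<parallel>\<close>. The rounded excess is at most \<open>(1 + 1/4) t \<parallel>y\<parallel>\<close> and
  the rounded increment at most \<open>(1/9 + 1 + 1/4) t \<parallel>y\<parallel>\<close>.\<close>

lemma discretization_Psi:
  fixes ys :: "'a::banach_lattice list"
  assumes scheme: "approximation_scheme E \<delta>" and ys: "ys \<in> Psi z"
  shows "map (\<lambda>i. \<delta> i (ys ! i)) [0..<length ys] \<in> Psi_tol 3 z \<inter> lists E"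
proof -
  have \<delta>: "\<delta> i y \<in> E \<and> 0 \<le> \<delta> i y \<and> \<delta> i y \<noteq> 0"
    "norm (\<delta> i y - y) \<le> norm y / (4 * 3 ^ Suc i)" if "0 \<le> y" "y \<noteq> 0" for i y
    using scheme that unfolding approximation_scheme_def by blast+
  define t :: "nat \<Rightarrow> real" where "t i = 1 / 3 ^ Suc i" for i
  have t: "0 < t i" "t (Suc i) = t i / 3" for i by (simp_all add: t_def)
  have t3: "t i \<le> 1 / 3" for i by (simp add: t_def)
  have P: "0 \<le> ys ! i" "ys ! i \<noteq> 0" "norm (pprt (ys ! i - z n)) \<le> norm (ys ! i) * t i"
    if "i < length ys" for i n
    using ys that by (auto simp: Psi_eq_Psi_tol Psi_tol_iff t_def)
  have step: "norm (ys ! Suc i - ys ! i) \<le> norm (ys ! i) * t i" if "Suc i < length ys" for i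
    using ys that by (auto simp: Psi_eq_Psi_tol Psi_tol_iff t_def)
  have d: "norm (\<delta> i (ys ! i) - ys ! i) \<le> norm (ys ! i) * t i / 4" if "i < length ys" for i
    using \<delta>(2)[OF P(1,2)[OF that], of i] by (simp add: t_def)
  have big: "11 / 12 * norm (ys ! i) \<le> norm (\<delta> i (ys ! i))" if "i < length ys" for i
  proof -
    have "norm (ys ! i) * t i \<le> norm (ys ! i) * (1 / 3)" using t3 by (intro mult_left_mono) auto
    then show ?thesis
      using d[OF that] norm_triangle_ineq2[of "ys ! i" "\<delta> i (ys ! i)"] by (simp add: norm_minus_commute)
  qed
  have big': "11 / 4 * (norm (ys ! i) * t i) \<le> 3 * norm (\<delta> i (ys ! i)) * t i" if "i < length ys" for i
    using mult_right_mono[OF big[OF that], of "t i"] t(1)[of i] by simp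
  have "norm (pprt (\<delta> i (ys ! i) - z n)) \<le> 3 * norm (\<delta> i (ys ! i)) * t i" if i: "i < length ys" for i n
  proof -
    have "norm (pprt (\<delta> i (ys ! i) - z n)) \<le> norm (pprt (ys ! i - z n)) + norm (\<delta> i (ys ! i) - ys ! i)"
      using norm_pprt_diff_le[of "\<delta> i (ys ! i) - z n" "ys ! i - z n"]
        norm_triangle_ineq2[of "pprt (\<delta> i (ys ! i) - z n)" "pprt (ys ! i - z n)"] by simp
    then show ?thesis
      using P(3)[OF i, of n] d[OF i] big'[OF i] mult_nonneg_nonneg[OF norm_ge_zero[of "ys ! i"], of "t i"]
        t(1)[of i] by linarith
  qed
  moreover have "norm (\<delta> (Suc i) (ys ! Suc i) - \<delta> i (ys ! i)) \<le> 3 * norm (\<delta> i (ys ! i)) * t i"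
    if i: "Suc i < length ys" for i
  proof -
    have i': "i < length ys" using i by simp
    have "norm (ys ! i) * t i \<le> norm (ys ! i) * (1 / 3)" using t3 by (intro mult_left_mono) auto
    then have "norm (ys ! Suc i) \<le> 4 / 3 * norm (ys ! i)"
      using step[OF i] norm_triangle_ineq2[of "ys ! Suc i" "ys ! i"] by simp
    then have "norm (ys ! Suc i) * t i \<le> 4 / 3 * (norm (ys ! i) * t i)"
      using mult_right_mono[of "norm (ys ! Suc i)" "4 / 3 * norm (ys ! i)" "t i"] t(1)[of i] by simp
    then have "norm (\<delta> (Suc i) (ys ! Suc i) - ys ! Suc i) \<le> 1 / 9 * (norm (ys ! i) * t i)"
      using d[OF i] by (simp add: t(2))
    moreover have "norm (\<delta> (Suc i) (ys ! Suc i) - \<delta> i (ys ! i)) \<le>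
        norm (\<delta> (Suc i) (ys ! Suc i) - ys ! Suc i) + norm (ys ! Suc i - ys ! i) +
        norm (\<delta> i (ys ! i) - ys ! i)"
      using dist_triangle[of "\<delta> (Suc i) (ys ! Suc i)" "\<delta> i (ys ! i)" "ys ! Suc i"]
        dist_triangle[of "ys ! Suc i" "\<delta> i (ys ! i)" "ys ! i"]
      by (simp add: dist_norm norm_minus_commute)
    ultimately show ?thesis
      using step[OF i] d[OF i'] big'[OF i'] mult_nonneg_nonneg[OF norm_ge_zero[of "ys ! i"], of "t i"]
        t(1)[of i] by linarith
  qed
  moreover have "map (\<lambda>i. \<delta> i (ys ! i)) [0..<length ys] \<in> lists E"
    using \<delta>(1) P(1,2) by (auto simp: in_lists_conv_set)
  ultimately show ?thesis
    unfolding Psi_tol_iff Int_iff using \<delta>(1) P(1,2) by (auto simp: t_def)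
qed

text \<open>Tolerances are attached to positions and shrink by the factor \<open>3\<close> from each position to the next,
  so moving every entry one position forward absorbs a factor \<open>3\<close>.\<close>

lemma tl_Psi_tol:
  assumes "ys \<in> Psi_tol 3 z"
  shows "tl ys \<in> Psi z"
proof -
  have shift: "3 * c / 3 ^ Suc (Suc i) = 1 * c / 3 ^ Suc i" for c :: real and i by simp
  have P: "0 \<le> ys ! Suc i \<and> ys ! Suc i \<noteq> 0 \<and>
      norm (pprt (ys ! Suc i - z n)) \<le> 1 * norm (ys ! Suc i) / 3 ^ Suc i"
    if "Suc i < length ys" for i n
    using assms that unfolding Psi_tol_iff shift[symmetric] by blast
  have S: "norm (ys ! Suc (Suc i) - ys ! Suc i) \<le> 1 * norm (ys ! Suc i) / 3 ^ Suc i"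
    if "Suc (Suc i) < length ys" for i
    using assms that unfolding Psi_tol_iff shift[symmetric] by blast
  show ?thesis
    unfolding Psi_eq_Psi_tol Psi_tol_iff length_tl less_diff_conv Suc_eq_plus1[symmetric]
  proof (intro conjI allI impI)
    fix i assume i: "Suc i < length ys"
    then have nth: "tl ys ! i = ys ! Suc i" by (simp add: nth_tl)
    show "0 \<le> tl ys ! i" "tl ys ! i \<noteq> 0" unfolding nth using P[OF i] by simp_all
    show "norm (pprt (tl ys ! i - z n)) \<le> 1 * norm (tl ys ! i) / 3 ^ Suc i" for n
      unfolding nth using P[OF i] by blast
  next
    fix i assume i: "Suc (Suc i) < length ys"
    then have nth: "tl ys ! i = ys ! Suc i" "tl ys ! Suc i = ys ! Suc (Suc i)"
      by (simp_all add: nth_tl)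
    show "norm (tl ys ! Suc i - tl ys ! i) \<le> 1 * norm (tl ys ! i) / 3 ^ Suc i"
      unfolding nth by (rule S[OF i])
  qed
qed

lemma branch_Psi_tol_tail:
  assumes "\<And>k. map y [0..<k] \<in> Psi_tol 3 z"
  shows "map (\<lambda>i. y (Suc i)) [0..<k] \<in> Psi z"
proof -
  have "map (\<lambda>i. y (Suc i)) [0..<k] = map y (map Suc [0..<k])" by simp
  also have "\<dots> = tl (map y [0..<Suc k])"
    unfolding map_Suc_upt by (simp add: upt_conv_Cons del: upt_Suc)
  finally show ?thesis using tl_Psi_tol[OF assms[of "Suc k"]] by (simp only:)
qed

lemma Psi_tol_append: "ys @ xs \<in> Psi_tol c z \<Longrightarrow> ys \<in> Psi_tol c z"
  unfolding Psi_tol_iff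
proof (elim conjE, intro conjI allI impI)
  assume a: "\<forall>i<length (ys @ xs). 0 \<le> (ys @ xs) ! i \<and> (ys @ xs) ! i \<noteq> 0 \<and>
      (\<forall>n. norm (pprt ((ys @ xs) ! i - z n)) \<le> c * norm ((ys @ xs) ! i) / 3 ^ Suc i)"
    and b: "\<forall>i. Suc i < length (ys @ xs) \<longrightarrow>
      norm ((ys @ xs) ! Suc i - (ys @ xs) ! i) \<le> c * norm ((ys @ xs) ! i) / 3 ^ Suc i"
  have nth: "(ys @ xs) ! i = ys ! i" if "i < length ys" for i using that by (simp add: nth_append)
  fix i
  show "0 \<le> ys ! i" "ys ! i \<noteq> 0" "norm (pprt (ys ! i - z n)) \<le> c * norm (ys ! i) / 3 ^ Suc i"
    if i: "i < length ys" for n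
    using a[rule_format, of i] i nth[OF i] by simp_all
  show "norm (ys ! Suc i - ys ! i) \<le> c * norm (ys ! i) / 3 ^ Suc i" if i: "Suc i < length ys"
    using b[rule_format, of i] i nth[OF i] nth[of i] by simp
qed

section \<open>The three implications\<close>

text \<open>Membership in \<^const>\<open>X_down0\<close> can be tested on the countable tree of strings over \<open>E\<close>. If it fails, a
  constant branch of \<open>\<Psi>(z)\<close> is rounded at each position separately, with increasing precision,
  and its tail is a branch over \<open>E\<close>.\<close>

lemma fatou_imp_borel:
  fixes \<alpha> :: "'a::separable_banach_lattice list set ordinal"
  assumes \<alpha>: "\<alpha> < omega1" and fatou: "fatou TYPE('a) \<alpha>"
  shows "(X_down0 :: (nat \<Rightarrow> 'a) set) \<in> sets borel"
proof -
  obtain E :: "'a set" and \<delta> where E: "countable E" and \<delta>: "approximation_scheme E \<delta>"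
    using approximation_scheme_exists by blast
  define T where "T z = Psi z \<inter> lists E" for z :: "nat \<Rightarrow> 'a"
  have "z \<in> X_down0 \<longleftrightarrow> z \<in> X_down \<and> rank_le (T z) \<alpha> []" for z :: "nat \<Rightarrow> 'a"
  proof
    assume z: "z \<in> X_down0"
    then have "tree_rank (Psi z) \<le> Fin \<alpha>" using fatou unfolding fatou_def X_down0_def by blast
    then have wf: "\<not> ill_founded (Psi z)" and le: "node_rank (Psi z) [] \<le> \<alpha>"
      unfolding tree_rank_le_Fin_iff by auto
    have "T z \<subseteq> Psi z" by (simp add: T_def)
    moreover have "[] \<in> Psi z" using tree_over_Psi[of z] unfolding tree_over_def by blast
    ultimately have "rank_le (T z) \<alpha> []"
      using rank_le_node_rank[OF tree_over_Psi wf] le by blast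
    then show "z \<in> X_down \<and> rank_le (T z) \<alpha> []" using z by (simp add: X_down0_def)
  next
    assume z: "z \<in> X_down \<and> rank_le (T z) \<alpha> []"
    show "z \<in> X_down0"
    proof (rule ccontr)
      assume "z \<notin> X_down0"
      then obtain l where l: "0 \<le> l" "l \<noteq> 0" "\<And>n. l \<le> z n"
        using z isGlb_zero_iff_no_positive_lower_bound[of z] unfolding X_down0_def by blast
      have const: "map (\<lambda>_. l) [0..<k] \<in> Psi z" for k by (rule constant_branch_Psi[OF l])
      have scheme: "map (\<lambda>i. \<delta> i l) [0..<k] \<in> Psi_tol 3 z \<inter> lists E" for k
      proof -
        have "map (\<lambda>i. \<delta> i (map (\<lambda>_. l) [0..<k] ! i)) [0..<length (map (\<lambda>_. l) [0..<k])]
            \<in> Psi_tol 3 z \<inter> lists E"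
          by (rule discretization_Psi[OF \<delta> const])
        also have "map (\<lambda>i. \<delta> i (map (\<lambda>_. l) [0..<k] ! i)) [0..<length (map (\<lambda>_. l) [0..<k])]
            = map (\<lambda>i. \<delta> i l) [0..<k]"
          by simp
        finally show ?thesis .
      qed
      have "map (\<lambda>i. \<delta> (Suc i) l) [0..<k] \<in> Psi z" for k
        using branch_Psi_tol_tail[of "\<lambda>i. \<delta> i l"] scheme by blast
      then have "map (\<lambda>i. \<delta> (Suc i) l) [0..<k] \<in> T z" for k
        unfolding T_def using \<delta> l(1,2) by (auto simp: in_lists_conv_set approximation_scheme_def)
      from rank_le_not_branch[of "\<lambda>i. \<delta> (Suc i) l", OF this, of \<alpha> 0] show False using z by simp
    qed
  qed
  then have eq: "X_down0 = X_down \<inter> {z. rank_le (T z) \<alpha> []}" by blast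
  have "{z. s \<in> T z} \<in> sets borel" for s
  proof -
    have "{z. s \<in> T z} = {z. s \<in> Psi_tol 1 z} \<inter> {z. s \<in> lists E}"
      by (auto simp: T_def Psi_eq_Psi_tol)
    then have "closed {z. s \<in> T z}"
      by (simp only: closed_Psi_tol closed_Int closed_Collect_const)
    then show ?thesis by (rule borel_closed)
  qed
  then have rank: "{z. rank_le (T z) \<alpha> []} \<in> sets borel"
    by (intro rank_le_borel[OF uncountable_list_set _ _ _ \<alpha>, of "lists E"])
      (auto simp: T_def E countable_lists)
  show ?thesis unfolding eq by (rule sets.Int[OF borel_closed[OF X_down_closed] rank])
qed

text \<open>Analytic sets are not closed under complements, so the induction over the generated
  \<open>\<sigma>\<close>-algebra carries the complement along.\<close>

lemma borel_imp_analytic_convergence: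
  assumes "(X_down0 :: (nat \<Rightarrow> 'a::separable_banach_lattice) set) \<in> sets borel"
  shows "analytic_set {(x :: nat \<Rightarrow> 'a, l :: 'a). sigma_order_converges x l}"
proof -
  define K where "K m n = {p :: ((nat \<Rightarrow> 'a) \<times> 'a) \<times> (nat \<Rightarrow> 'a).
    \<bar>fst (fst p) n - snd (fst p)\<bar> \<le> snd p m}" for m n
  have coord: "continuous_on UNIV (\<lambda>p. f p n)" if "continuous_on UNIV f"
    for f :: "((nat \<Rightarrow> 'a) \<times> 'a) \<times> (nat \<Rightarrow> 'a) \<Rightarrow> nat \<Rightarrow> 'a" and n
    using that by (rule continuous_on_product_then_coordinatewise)
  have K: "closed (K m n)" for m n
    unfolding K_def
    by (intro closed_Collect_le_lattice continuous_on_abs_lattice continuous_on_diff coord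
        continuous_on_fst continuous_on_snd continuous_on_id)
  define W where "W = snd -` X_down0 \<inter> (\<Inter>m. \<Union>N. \<Inter>n\<in>{N..}. K m n)"
  have "snd \<in> borel_measurable (borel :: (((nat \<Rightarrow> 'a) \<times> 'a) \<times> (nat \<Rightarrow> 'a)) measure)"
    by (intro borel_measurable_continuous_onI continuous_on_snd continuous_on_id)
  then have "snd -` (X_down0 :: (nat \<Rightarrow> 'a) set) \<in>
      sets (borel :: (((nat \<Rightarrow> 'a) \<times> 'a) \<times> (nat \<Rightarrow> 'a)) measure)"
    using assms by (rule measurable_sets_borel)
  moreover have "(\<Inter>n\<in>{N..}. K m n) \<in> sets borel" for m N
    by (intro borel_closed closed_INT ballI K)
  ultimately have "W \<in> sets borel"
    unfolding W_def by (intro sets.Int sets.countable_INT'' sets.countable_UN) auto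
  then have "analytic_set (fst ` W)" by (intro analytic_set_fst_image borel_imp_analytic)
  moreover have "{(x :: nat \<Rightarrow> 'a, l :: 'a). sigma_order_converges x l} = fst ` W"
  proof (intro set_eqI iffI)
    fix p :: "(nat \<Rightarrow> 'a) \<times> 'a"
    assume "p \<in> {(x, l). sigma_order_converges x l}"
    then obtain z where z: "decseq z" "isGlb UNIV (range z) 0"
      "\<forall>m. \<forall>\<^sub>F n in sequentially. \<bar>fst p n - snd p\<bar> \<le> z m"
      unfolding sigma_order_converges_def by auto
    have "z \<in> X_down0" using z(1,2) isGlb_zero_iff[of z] by (simp add: X_down0_def X_down_def)
    then have "(p, z) \<in> W"
      using z(3) unfolding W_def K_def eventually_sequentially by (simp add: atLeast_def)
    then show "p \<in> fst ` W" by force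
  next
    fix p assume "p \<in> fst ` W"
    then obtain z where z: "(p, z) \<in> W" by force
    then have "z \<in> X_down0" "\<forall>m. \<forall>\<^sub>F n in sequentially. \<bar>fst p n - snd p\<bar> \<le> z m"
      unfolding W_def K_def eventually_sequentially by (simp_all add: atLeast_def)
    then have "sigma_order_converges (fst p) (snd p)"
      unfolding sigma_order_converges_def X_down0_def X_down_def by blast
    then show "p \<in> {(x, l). sigma_order_converges x l}" by (simp add: case_prod_beta)
  qed
  ultimately show ?thesis by simp
qed

text \<open>All the trees \<open>\<Psi>(z)\<close> for \<open>z \<in> A\<close> embed into one well-founded tree \<open>U\<close> over a countable alphabet, whose
  strings guess a code of \<open>z\<close> in the Baire space along with a rounded string of \<open>\<Psi>(z)\<close>.\<close>

lemma analytic_imp_bounded_rank: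
  fixes A :: "(nat \<Rightarrow> 'a::separable_banach_lattice) set"
  assumes "analytic_set A" and sub: "A \<subseteq> X_down0"
  shows "\<exists>\<alpha>::'a list set ordinal. \<alpha> < omega1 \<and> (\<forall>z\<in>A. node_rank (Psi z) [] < \<alpha>)"
proof (cases "A = {}")
  case True
  then show ?thesis
    using countable_bounded_below_omega1[OF uncountable_list_set, of "{}"] by auto
next
  case False
  obtain F and \<phi> :: "(nat \<Rightarrow> nat) \<Rightarrow> nat \<Rightarrow> 'a" where F: "closed F" and \<phi>: "continuous_on UNIV \<phi>" and A: "A = \<phi> ` F"
    using analytic_set_continuous_image[OF assms(1)] .
  obtain E :: "'a set" and \<delta> where E: "countable E" and \<delta>: "approximation_scheme E \<delta>"
    using approximation_scheme_exists by blast
  define U where "U = {t \<in> lists (UNIV \<times> E). \<exists>a\<in>F. map fst t = map a [0..<length t] \<and>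
    map snd t \<in> Psi_tol 3 (\<phi> a)}"
  have treeU: "tree_over (UNIV \<times> E) U"
    unfolding tree_over_def
  proof (intro conjI ballI allI impI)
    show "U \<subseteq> lists (UNIV \<times> E)" by (auto simp: U_def)
    show "[] \<in> U" using False by (auto simp: U_def A Psi_tol_iff)
    fix t s assume "t \<in> U" "prefix s t"
    then obtain u a where t: "t = s @ u" "t \<in> lists (UNIV \<times> E)" "a \<in> F"
      "map fst t = map a [0..<length t]" "map snd t \<in> Psi_tol 3 (\<phi> a)"
      unfolding U_def prefix_def by blast
    have "map fst s = take (length s) (map fst t)" using t(1) by simp
    also have "\<dots> = map a [0..<length s]" unfolding t(4) using t(1) by (simp add: take_map)
    finally have "map fst s = map a [0..<length s]" .
    moreover have "map snd s \<in> Psi_tol 3 (\<phi> a)"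
      using t(5) Psi_tol_append unfolding t(1) map_append by blast
    ultimately show "s \<in> U" using t(1-3) unfolding U_def by auto
  qed
  have wfU: "\<not> ill_founded U"
  proof
    assume "ill_founded U"
    then obtain y where y: "map y [0..<n] \<in> U" for n unfolding ill_founded_def by blast
    define a where "a i = fst (y i)" for i
    define d where "d i = snd (y i)" for i
    have "\<forall>n. \<exists>b. b \<in> F \<and> (\<forall>i<n. b i = a i) \<and> map d [0..<n] \<in> Psi_tol 3 (\<phi> b)"
    proof
      fix n
      obtain b where b: "b \<in> F" "map fst (map y [0..<n]) = map b [0..<n]"
        "map snd (map y [0..<n]) \<in> Psi_tol 3 (\<phi> b)"
        using y[of n] unfolding U_def by auto
      have "\<forall>i<n. b i = a i" using b(2) by (simp add: a_def)
      moreover have "map snd (map y [0..<n]) = map d [0..<n]" by (simp add: d_def)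
      ultimately show "\<exists>b. b \<in> F \<and> (\<forall>i<n. b i = a i) \<and> map d [0..<n] \<in> Psi_tol 3 (\<phi> b)"
        using b(1,3) by metis
    qed
    (* The codes b n that witness the initial segments of the branch converge to its first component. *)
    from choice[OF this] obtain b where
      "\<forall>n. b n \<in> F \<and> (\<forall>i<n. b n i = a i) \<and> map d [0..<n] \<in> Psi_tol 3 (\<phi> (b n))" ..
    then have b: "b n \<in> F" "i < n \<Longrightarrow> b n i = a i" "map d [0..<n] \<in> Psi_tol 3 (\<phi> (b n))" for n i
      by blast+
    have lim: "b \<longlonglongrightarrow> a" using b(2) by (rule LIMSEQ_agree_on_initial_segments)
    then have "a \<in> F" using F b(1) closed_sequentially by blast
    have lim\<phi>: "(\<lambda>n. \<phi> (b n)) \<longlonglongrightarrow> \<phi> a"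
      by (rule continuous_on_tendsto_compose[OF \<phi> lim]) simp_all
    have "map d [0..<k] \<in> Psi_tol 3 (\<phi> a)" for k
    proof -
      have "map d [0..<k] \<in> Psi_tol 3 (\<phi> (b (n + k)))" for n
      proof -
        have "map d [0..<n + k] = map d [0..<k] @ map d [k..<k + n]"
          by (simp add: add.commute flip: map_append upt_add_eq_append)
        then show ?thesis using b(3)[of "n + k"] Psi_tol_append by metis
      qed
      moreover have "(\<lambda>n. \<phi> (b (n + k))) \<longlonglongrightarrow> \<phi> a"
        using lim\<phi> by (rule LIMSEQ_ignore_initial_segment)
      ultimately show ?thesis
        using closed_sequentially[OF closed_Psi_tol[of "map d [0..<k]" 3],
            of "\<lambda>n. \<phi> (b (n + k))" "\<phi> a"] by simp
    qed
    then have "map (\<lambda>i. d (Suc i)) [0..<k] \<in> Psi (\<phi> a)" for k by (rule branch_Psi_tol_tail)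
    then have "ill_founded (Psi (\<phi> a))" unfolding ill_founded_def by blast
    then show False using \<open>a \<in> F\<close> A sub X_down0_iff_well_founded by blast
  qed
  define R where "R = {(t, s). t \<in> U \<and> s \<in> U \<and> strict_prefix s t}"
  have "wf R" unfolding R_def by (rule wf_extension[OF treeU wfU])
  moreover have "countable {t. (t, s) \<in> R}" for s
  proof (rule countable_subset)
    show "{t. (t, s) \<in> R} \<subseteq> lists (UNIV \<times> E)" by (auto simp: R_def U_def)
    show "countable (lists ((UNIV :: nat set) \<times> E))" using E by (intro countable_lists) simp
  qed
  ultimately obtain r :: "(nat \<times> 'a) list \<Rightarrow> 'a list set ordinal"
    where r: "\<And>x. r x < omega1" "\<And>x y. (x, y) \<in> R \<Longrightarrow> r x < r y"
    using countable_wf_rank[OF uncountable_list_set] by metis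
  have "node_rank (Psi z) [] \<le> r []" if z: "z \<in> A" for z
  proof -
    obtain a where a: "a \<in> F" "z = \<phi> a" using z A by blast
    have wf: "\<not> ill_founded (Psi z)" using z sub X_down0_iff_well_founded by blast
    define e where "e ys = map (\<lambda>i. (a i, \<delta> i (ys ! i))) [0..<length ys]" for ys
    have eU: "e ys \<in> U" if ys: "ys \<in> Psi z" for ys
    proof -
      have "map snd (e ys) \<in> Psi_tol 3 (\<phi> a) \<inter> lists E"
        using discretization_Psi[OF \<delta> ys] by (simp add: e_def a(2) comp_def)
      moreover have "map fst (e ys) = map a [0..<length (e ys)]" by (simp add: e_def comp_def)
      moreover have "e ys \<in> lists (UNIV \<times> E)"
        using calculation(1) by (auto simp: in_lists_conv_set mem_Times_iff)
      ultimately show ?thesis using a(1) unfolding U_def by blast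
    qed
    have eR: "(e xs, e ys) \<in> R" if ext: "xs \<in> Psi z" "ys \<in> Psi z" "strict_prefix ys xs" for xs ys
    proof -
      obtain us where us: "xs = ys @ us" "us \<noteq> []"
        using ext(3) by (auto simp: strict_prefix_def prefix_def)
      have "e ys = take (length ys) (e xs)"
        by (simp add: e_def us take_map nth_append)
      moreover have "length (e ys) < length (e xs)" using us by (simp add: e_def)
      ultimately have "strict_prefix (e ys) (e xs)"
        by (metis less_irrefl strict_prefixI take_is_prefix)
      then show ?thesis using eU ext(1,2) unfolding R_def by blast
    qed
    have "s \<in> Psi z \<longrightarrow> node_rank (Psi z) s \<le> r (e s)" for s
      using wf_extension[OF tree_over_Psi wf]
    proof (induction s rule: wf_induct_rule)
      case (less s)
      show ?case
      proof
        assume s: "s \<in> Psi z"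
        have "node_rank (Psi z) t < r (e s)" if t: "t \<in> Psi z" "strict_prefix s t" for t
        proof -
          have "node_rank (Psi z) t \<le> r (e t)" using less t s by blast
          also have "\<dots> < r (e s)" by (rule r(2)[OF eR[OF t(1) s t(2)]])
          finally show ?thesis .
        qed
        then show "node_rank (Psi z) s \<le> r (e s)"
          unfolding node_rank_le_iff[OF tree_over_Psi wf s] by blast
      qed
    qed
    moreover have "[] \<in> Psi z" using tree_over_Psi[of z] unfolding tree_over_def by blast
    moreover have "e [] = []" by (simp add: e_def)
    ultimately show ?thesis by metis
  qed
  moreover obtain \<alpha> where "\<alpha> < omega1" "r [] < \<alpha>"
    using countable_bounded_below_omega1[OF uncountable_list_set, of "{r []}"] r(1) by auto
  ultimately show ?thesis by (meson order_le_less_trans)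
qed

lemma analytic_convergence_imp_fatou:
  assumes "analytic_set {(x :: nat \<Rightarrow> 'a::separable_banach_lattice, l :: 'a). sigma_order_converges x l}"
  shows "\<exists>\<alpha>::'a list set ordinal. \<alpha> < omega1 \<and> fatou TYPE('a) \<alpha>"
proof -
  define S where "S = {(x :: nat \<Rightarrow> 'a, l :: 'a). sigma_order_converges x l}"
  have "continuous_on UNIV (\<lambda>z :: nat \<Rightarrow> 'a. (z, 0 :: 'a))"
    by (intro continuous_on_Pair continuous_on_id continuous_on_const)
  then have "analytic_set ((\<lambda>z. (z, 0)) -` S)"
    using assms unfolding S_def[symmetric] by (rule analytic_set_vimage)
  then have "analytic_set (X_down \<inter> (\<lambda>z. (z, 0)) -` S)"
    using analytic_set_Int analytic_set_closed X_down_closed by blast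
  moreover have "X_down0 = X_down \<inter> (\<lambda>z. (z, 0)) -` S"
    unfolding X_down0_def S_def using sigma_order_converges_zero_iff by auto
  ultimately have "analytic_set (X_down0 :: (nat \<Rightarrow> 'a) set)" by simp
  then obtain \<alpha> :: "'a list set ordinal" where \<alpha>: "\<alpha> < omega1"
    "\<forall>z\<in>(X_down0 :: (nat \<Rightarrow> 'a) set). node_rank (Psi z) [] < \<alpha>"
    using analytic_imp_bounded_rank by blast
  have "isGlb UNIV (range z) 0 \<longleftrightarrow> tree_rank (Psi z) \<le> Fin \<alpha>" if z: "z \<in> X_down" for z :: "nat \<Rightarrow> 'a"
    using \<alpha>(2) z ill_founded_Psi_iff[OF z] unfolding tree_rank_le_Fin_iff X_down0_def by blast
  then have "fatou TYPE('a) \<alpha>" unfolding fatou_def by blast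
  then show ?thesis using \<alpha>(1) by blast
qed

theorem theorem1p2:
  shows "((X_down0 :: (nat \<Rightarrow> 'a::separable_banach_lattice) set) \<in> sets borel
            \<longleftrightarrow> analytic_set {(x :: nat \<Rightarrow> 'a, l :: 'a). sigma_order_converges x l})
       \<and> (analytic_set {(x :: nat \<Rightarrow> 'a, l :: 'a). sigma_order_converges x l}
            \<longleftrightarrow> (\<exists>\<alpha> :: 'a list set ordinal. \<alpha> < omega1 \<and> fatou TYPE('a) \<alpha>))"
  using fatou_imp_borel borel_imp_analytic_convergence analytic_convergence_imp_fatou by blast

end
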